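(* Let $\mathbb{F}$ be a field and let $F \colon [0,\infty]^2 \to \mathsf{Vec}_{\mathbb{F}}$ be a pointwise finite-dimensional middle-exact functor. Then $F$ decomposes into a direct sum of interval modules over blocks.
   Context: $\mathsf{Vec}_{\mathbb{F}}$ is the category of $\mathbb{F}$-vector spaces. $[0,\infty]$ is the totally ordered set of nonnegative reals with a maximal element $\infty$ added, and $P=[0,\infty]^2$ carries the product partial order (a distributive lattice); posets are regarded as categories. Pointwise finite-dimensional means $F(x)$ is finite-dimensional for all $x$. $F$ is middle-exact if for all $x,y\in P$ the sequence $F(x\wedge y)\to F(x)\oplus F(y)\to F(x\vee y)$ is exact in the middle, where the first map has as components the two structure maps and the second is the difference of the two structure maps. An interval in a poset is a subset $I$ such that (a) $x,y\in I$ and $x\le z\le y$ imply $z\in I$, and (b) any $x,y\in I$ are connected by a zigzag $x=a_0\le b_0\ge a_1\le\dots\le b_n=y$ of relations in $I$. The interval module $\mathbb{F}_I$ has $\mathbb{F}_I(x)=\mathbb{F}$ if $x\in I$ and $0$ otherwise, with $\mathbb{F}_I(x\le y)=\mathrm{id}_{\mathbb{F}}$ if $x,y\in I$ and $0$ otherwise. A block is an interval $I\subseteq[0,\infty]^2$ of one of the following forms: $J_1\times J_2$ with $J_1,J_2\subseteq[0,\infty]$ down-closed (death block); $J_1\times J_2$ with $J_1,J_2\subseteq[0,\infty]$ up-closed (birth block); $J\times[0,\infty]$ with $J\subseteq[0,\infty]$ an interval (vertical block); $[0,\infty]\times J$ with $J\subseteq[0,\infty]$ an interval (horizontal block). Here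 $J$ is down-closed (resp. up-closed) if $x\in J$ and $y\le x$ (resp. $y\ge x$) imply $y\in J$. *)

theory Defs
  imports
    "HOL-Library.Extended_Nonnegative_Real"
    "HOL-Library.Product_Order"
    "HOL-Library.Function_Algebras"
begin

section \<open>Functors from a poset to vector spaces\<close>

definition linear_between ::
  "('k::field \<Rightarrow> 'v::ab_group_add \<Rightarrow> 'v) \<Rightarrow> ('k \<Rightarrow> 'w::ab_group_add \<Rightarrow> 'w) \<Rightarrow>
   'v set \<Rightarrow> 'w set \<Rightarrow> ('v \<Rightarrow> 'w) \<Rightarrow> bool" where
  "linear_between s t V W h \<longleftrightarrow>
     h ` V \<subseteq> W \<and>
     (\<forall>u\<in>V. \<forall>v\<in>V. h (u + v) = h u + h v) \<and>
     (\<forall>c. \<forall>v\<in>V. h (s c v) = t c (h v))"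

text \<open>
  The values of a functor are subspaces of a common ambient vector space, since a family of types
  indexed by the elements of the poset is not available. This is no restriction: every family of
  vector spaces embeds in its direct sum. The structure map \<open>f x y\<close> only matters
  for \<open>x \<le> y\<close>, and only on \<open>V x\<close>.
\<close>

locale vec_functor = vector_space s
  for s :: "'k::field \<Rightarrow> 'v::ab_group_add \<Rightarrow> 'v" +
  fixes V :: "'p::order \<Rightarrow> 'v set"
    and f :: "'p \<Rightarrow> 'p \<Rightarrow> 'v \<Rightarrow> 'v"
  assumes subspace_V: "subspace (V x)"
    and linear_f: "x \<le> y \<Longrightarrow> linear_between s s (V x) (V y) (f x y)"
    and f_id: "v \<in> V x \<Longrightarrow> f x x v = v"
    and f_comp: "x \<le> y \<Longrightarrow> y \<le> z \<Longrightarrow> v \<in> V x \<Longrightarrow> f y z (f x y v) = f x z v"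

definition pointwise_finite_dim ::
  "('k::field \<Rightarrow> 'v::ab_group_add \<Rightarrow> 'v) \<Rightarrow> ('p \<Rightarrow> 'v set) \<Rightarrow> bool" where
  "pointwise_finite_dim s V \<longleftrightarrow> (\<forall>x. \<exists>B. finite B \<and> module.span s B = V x)"

definition middle_exact ::
  "('p::lattice \<Rightarrow> 'v::ab_group_add set) \<Rightarrow> ('p \<Rightarrow> 'p \<Rightarrow> 'v \<Rightarrow> 'v) \<Rightarrow> bool" where
  "middle_exact V f \<longleftrightarrow>
     (\<forall>x y. (\<lambda>v. (f (inf x y) x v, f (inf x y) y v)) ` V (inf x y) =
            {(a, b) \<in> V x \<times> V y. f x (sup x y) a - f y (sup x y) b = 0})"

definition vec_functor_iso ::
  "('k::field \<Rightarrow> 'v::ab_group_add \<Rightarrow> 'v) \<Rightarrow> ('p::order \<Rightarrow> 'v set) \<Rightarrow> ('p \<Rightarrow> 'p \<Rightarrow> 'v \<Rightarrow> 'v) \<Rightarrow>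
   ('k \<Rightarrow> 'w::ab_group_add \<Rightarrow> 'w) \<Rightarrow> ('p \<Rightarrow> 'w set) \<Rightarrow> ('p \<Rightarrow> 'p \<Rightarrow> 'w \<Rightarrow> 'w) \<Rightarrow> bool" where
  "vec_functor_iso s V f t W g \<longleftrightarrow>
     (\<exists>\<phi>. (\<forall>x. linear_between s t (V x) (W x) (\<phi> x) \<and> bij_betw (\<phi> x) (V x) (W x)) \<and>
          (\<forall>x y. x \<le> y \<longrightarrow> (\<forall>v\<in>V x. \<phi> y (f x y v) = g x y (\<phi> x v))))"


section \<open>Direct sums\<close>

text \<open>
  The direct sum over an index set \<open>A\<close> consists of the finitely supported families, extended
  by \<open>0\<close> outside of \<open>A\<close>. Addition of families is the pointwise one.
\<close>

definition dsum_scale :: "('k \<Rightarrow> 'v \<Rightarrow> 'v) \<Rightarrow> 'k \<Rightarrow> ('i \<Rightarrow> 'v) \<Rightarrow> 'i \<Rightarrow> 'v" where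
  "dsum_scale s c u = (\<lambda>i. s c (u i))"

definition dsum_space :: "'i set \<Rightarrow> ('i \<Rightarrow> 'p \<Rightarrow> 'v::zero set) \<Rightarrow> 'p \<Rightarrow> ('i \<Rightarrow> 'v) set" where
  "dsum_space A V x =
     {u. finite {i. u i \<noteq> 0} \<and> (\<forall>i\<in>A. u i \<in> V i x) \<and> (\<forall>i. i \<notin> A \<longrightarrow> u i = 0)}"

definition dsum_map ::
  "'i set \<Rightarrow> ('i \<Rightarrow> 'p \<Rightarrow> 'p \<Rightarrow> 'v::zero \<Rightarrow> 'v) \<Rightarrow> 'p \<Rightarrow> 'p \<Rightarrow> ('i \<Rightarrow> 'v) \<Rightarrow> 'i \<Rightarrow> 'v" where
  "dsum_map A f x y u = (\<lambda>i. if i \<in> A then f i x y (u i) else 0)"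


section \<open>Intervals, interval modules and blocks\<close>

definition poset_interval :: "'p::order set \<Rightarrow> bool" where
  "poset_interval I \<longleftrightarrow>
     (\<forall>x\<in>I. \<forall>y\<in>I. \<forall>z. x \<le> z \<and> z \<le> y \<longrightarrow> z \<in> I) \<and>
     (\<forall>x\<in>I. \<forall>y\<in>I. \<exists>n (a :: nat \<Rightarrow> 'p) b.
        a 0 = x \<and> b n = y \<and>
        (\<forall>i\<le>n. a i \<in> I \<and> b i \<in> I \<and> a i \<le> b i) \<and>
        (\<forall>i<n. a (Suc i) \<le> b i))"

definition interval_space :: "'p set \<Rightarrow> 'p \<Rightarrow> 'k::field set" where
  "interval_space I x = (if x \<in> I then UNIV else {0})"

definition interval_map :: "'p set \<Rightarrow> 'p \<Rightarrow> 'p \<Rightarrow> 'k::field \<Rightarrow> 'k" where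
  "interval_map I x y c = (if x \<in> I \<and> y \<in> I then c else 0)"

definition down_closed :: "'p::order set \<Rightarrow> bool" where
  "down_closed J \<longleftrightarrow> (\<forall>x\<in>J. \<forall>y. y \<le> x \<longrightarrow> y \<in> J)"

definition up_closed :: "'p::order set \<Rightarrow> bool" where
  "up_closed J \<longleftrightarrow> (\<forall>x\<in>J. \<forall>y. x \<le> y \<longrightarrow> y \<in> J)"

definition death_block :: "(ennreal \<times> ennreal) set \<Rightarrow> bool" where
  "death_block I \<longleftrightarrow> (\<exists>J1 J2. down_closed J1 \<and> down_closed J2 \<and> I = J1 \<times> J2)"

definition birth_block :: "(ennreal \<times> ennreal) set \<Rightarrow> bool" where
  "birth_block I \<longleftrightarrow> (\<exists>J1 J2. up_closed J1 \<and> up_closed J2 \<and> I = J1 \<times> J2)"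

definition vertical_block :: "(ennreal \<times> ennreal) set \<Rightarrow> bool" where
  "vertical_block I \<longleftrightarrow> (\<exists>J. poset_interval J \<and> I = J \<times> UNIV)"

definition horizontal_block :: "(ennreal \<times> ennreal) set \<Rightarrow> bool" where
  "horizontal_block I \<longleftrightarrow> (\<exists>J. poset_interval J \<and> I = UNIV \<times> J)"

definition block :: "(ennreal \<times> ennreal) set \<Rightarrow> bool" where
  "block I \<longleftrightarrow> poset_interval I \<and>
     (death_block I \<or> birth_block I \<or> vertical_block I \<or> horizontal_block I)"


section \<open>Interval modules and direct sums are functors\<close>

lemma vec_functor_interval:
  assumes "poset_interval I"
  shows "vec_functor ((*) :: 'k::field \<Rightarrow> 'k \<Rightarrow> 'k) (interval_space I) (interval_map I)"
proof -
  interpret vector_space "(*) :: 'k \<Rightarrow> 'k \<Rightarrow> 'k"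
    by unfold_locales (simp_all add: algebra_simps)
  have convex: "z \<in> I" if "x \<in> I" "y \<in> I" "x \<le> z" "z \<le> y" for x y z
    using assms that unfolding poset_interval_def by blast
  show ?thesis
  proof
    show "subspace (interval_space I x)" for x
      by (simp add: subspace_def interval_space_def)
    show "linear_between (*) (*) (interval_space I x) (interval_space I y) (interval_map I x y)" for x y
      by (auto simp: linear_between_def interval_space_def interval_map_def)
    show "interval_map I x x v = v" if "v \<in> interval_space I x" for x and v :: 'k
      using that by (simp add: interval_space_def interval_map_def split: if_splits)
    show "interval_map I y z (interval_map I x y v) = interval_map I x z v"
      if "x \<le> y" "y \<le> z" for x y z and v :: 'k
      using that convex[of x z y] by (simp add: interval_map_def)
  qed
qed

lemma vec_functor_dsum:
  fixes s :: "'k::field \<Rightarrow> 'v::ab_group_add \<Rightarrow> 'v"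
  assumes s: "vector_space s" and F: "\<And>i. i \<in> A \<Longrightarrow> vec_functor s (V i) (f i)"
  shows "vec_functor (dsum_scale s) (dsum_space A V) (dsum_map A f)"
proof -
  interpret S: vector_space s by fact
  interpret D: vector_space "dsum_scale s :: 'k \<Rightarrow> ('i \<Rightarrow> 'v) \<Rightarrow> 'i \<Rightarrow> 'v"
    by unfold_locales
      (auto simp: dsum_scale_def fun_eq_iff S.scale_right_distrib S.scale_left_distrib)
  have sub: "S.subspace (V i x)" if "i \<in> A" for i x
    using vec_functor.subspace_V[OF F[OF that]] .
  have lin: "linear_between s s (V i x) (V i y) (f i x y)" if "i \<in> A" "x \<le> y" for i x y
    using vec_functor.linear_f[OF F[OF that(1)] that(2)] .
  have maps: "f i x y v \<in> V i y" if "i \<in> A" "x \<le> y" "v \<in> V i x" for i x y v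
    using lin[OF that(1,2)] that(3) by (auto simp: linear_between_def)
  have f0: "f i x y 0 = 0" if "i \<in> A" "x \<le> y" for i x y
    using lin[OF that] S.subspace_0[OF sub[OF that(1), of x]]
    unfolding linear_between_def by (metis S.scale_zero_left)
  show ?thesis
  proof
    fix x
    show "D.subspace (dsum_space A V x)"
    proof (rule D.subspaceI)
      show "0 \<in> dsum_space A V x"
        by (auto simp: dsum_space_def S.subspace_0[OF sub])
    next
      fix u v assume uv: "u \<in> dsum_space A V x" "v \<in> dsum_space A V x"
      then have "finite ({i. u i \<noteq> 0} \<union> {i. v i \<noteq> 0})" by (simp add: dsum_space_def)
      then have "finite {i. u i + v i \<noteq> 0}" by (rule rev_finite_subset) auto
      with uv show "u + v \<in> dsum_space A V x"
        by (auto simp: dsum_space_def intro: S.subspace_add[OF sub])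
    next
      fix c u assume u: "u \<in> dsum_space A V x"
      then have "finite {i. u i \<noteq> 0}" by (simp add: dsum_space_def)
      then have "finite {i. s c (u i) \<noteq> 0}" by (rule rev_finite_subset) auto
      with u show "dsum_scale s c u \<in> dsum_space A V x"
        by (auto simp: dsum_space_def dsum_scale_def intro: S.subspace_scale[OF sub])
    qed
  next
    fix x y :: 'b assume xy: "x \<le> y"
    have "dsum_map A f x y u \<in> dsum_space A V y" if u: "u \<in> dsum_space A V x" for u
    proof -
      have "finite {i. u i \<noteq> 0}" using u by (simp add: dsum_space_def)
      then have "finite {i. dsum_map A f x y u i \<noteq> 0}"
        by (rule rev_finite_subset) (auto simp: dsum_map_def f0[OF _ xy])
      then show ?thesis
        using u maps[OF _ xy] by (auto simp: dsum_space_def dsum_map_def)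
    qed
    then show "linear_between (dsum_scale s) (dsum_scale s)
        (dsum_space A V x) (dsum_space A V y) (dsum_map A f x y)"
      using lin[OF _ xy]
      by (auto simp: linear_between_def dsum_space_def dsum_map_def dsum_scale_def fun_eq_iff)
  next
    fix v x assume "v \<in> dsum_space A V x"
    then show "dsum_map A f x x v = v"
      by (auto simp: dsum_space_def dsum_map_def fun_eq_iff vec_functor.f_id[OF F])
  next
    fix x y z :: 'b and v assume "x \<le> y" "y \<le> z" "v \<in> dsum_space A V x"
    then show "dsum_map A f y z (dsum_map A f x y v) = dsum_map A f x z v"
      by (auto simp: dsum_space_def dsum_map_def fun_eq_iff vec_functor.f_comp[OF F])
  qed
qed

end

(* A section e of the functor with support I spans a copy of the interval module of I, and if I is
   directed and e z is never in the span of what arrives from outside of I, then a functional on the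
   colimit over I that is 1 on e cuts out a complement, which is again middle-exact. Hence it is enough
   to find such a section, supported on a block, in every nonzero functor V: by finite dimension a
   descending chain of complements is stationary at each point, and Zorn's lemma does the rest.

   If V (0, 0) is nonzero, take a vector of V (0, 0) adapted to the two flags of kernels of the maps to
   the axes; it spans a death block. If V (0, 0) = 0 but some V (t, 0) is nonzero, take a vector of
   V (t, 0) adapted to the flags of kernels and images of the one-parameter module on the axis, lift it
   backwards, and push it up; exactness makes the result a vertical block. Symmetrically for the other
   axis. If V vanishes on both axes, all structure maps are injective, and a vector of V (top, top)
   adapted to the two flags of images spans a birth block. *)
theory Submission
  imports Defs
begin

section \<open>Flags and functionals\<close>

text \<open>The parameters form a continuum: a block need not contain its end points, and nothing
  can be lifted or extended one step at a time. Finite dimension at each point compensates, since a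
  chain of subspaces of one \<open>V x\<close> has a least member. As a block may lack a largest
  point, the functional has to live on a colimit; and as it must kill everything arriving from
  outside at once, the span of these vectors, and not only each image, has to avoid the section.
  Adapted means that \<open>e = u + v\<close>, with \<open>u\<close> and \<open>v\<close> in members
  of the two flags, happens only if one of these members contains \<open>e\<close>. In the death
  case exactness writes a kernel as a sum of two kernels, and adaptedness makes the support a
  product. In the birth case it writes an image as an intersection of two images; the support is a
  product at once, and adaptedness keeps \<open>e\<close> out of the sum of what arrives from
  outside. The cases are ordered so that the vanishing known in the later ones gives, by exactness,
  the injectivity they need.\<close>

context vector_space
begin

text \<open>A member of least dimension does it: in a chain, a member that fails to contain it lies
  properly inside it and has smaller dimension. Besides flags, this is applied to images along a
  sequence and to remainders along a chain in Zorn's lemma.\<close>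

lemma chain_least_subspace:
  assumes "finite B" and "C \<noteq> {}"
    and sub: "\<And>U. U \<in> C \<Longrightarrow> subspace U \<and> U \<subseteq> span B"
    and chain: "\<And>U W. U \<in> C \<Longrightarrow> W \<in> C \<Longrightarrow> U \<subseteq> W \<or> W \<subseteq> U"
  obtains U where "U \<in> C" "\<And>W. W \<in> C \<Longrightarrow> U \<subseteq> W"
proof -
  obtain U where U: "U \<in> C" "\<And>W. W \<in> C \<Longrightarrow> dim U \<le> dim W"
    using ex_has_least_nat[of "\<lambda>U. U \<in> C" _ dim] \<open>C \<noteq> {}\<close> by blast
  have "U \<subseteq> W" if W: "W \<in> C" for W
  proof (rule ccontr)
    assume not: "\<not> U \<subseteq> W"
    then have "W \<subseteq> U" using chain[OF U(1) W] by blast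
    obtain u where u: "u \<in> U" "u \<notin> W" using not by blast
    obtain A where A: "A \<subseteq> W" "independent A" "W \<subseteq> span A" "card A = dim W"
      using basis_exists[of W] by blast
    have "span A \<subseteq> W" using A(1) sub[OF W] by (simp add: span_minimal)
    then have "u \<notin> span A" using u by blast
    then have ind: "independent (insert u A)" using A(2) by (simp add: independent_insert)
    have "insert u A \<subseteq> U" using u \<open>W \<subseteq> U\<close> A(1) by blast
    then obtain D where D: "insert u A \<subseteq> D" "D \<subseteq> U" "independent D" "U \<subseteq> span D"
      using maximal_independent_subset_extend[OF _ ind] by blast
    have "D \<subseteq> span B" using D(2) sub[OF U(1)] by blast
    then have "finite D" using independent_span_bound[OF \<open>finite B\<close> D(3)] by blast
    moreover have "card D = dim U" using basis_card_eq_dim[OF D(2,4,3)] .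
    moreover have "u \<notin> A" using u A(1) by blast
    ultimately have "dim W < dim U"
      using A(4) card_mono[OF _ D(1)] finite_subset[OF D(1)] by simp
    then show False using U(2)[OF W] by simp
  qed
  with U(1) show thesis by (rule that)
qed

lemma subspace_in_general_position_wrt_chain:
  assumes "finite B" "W \<subseteq> span B" "subspace W" "W \<noteq> {0}"
    and K: "\<And>i. i \<in> S \<Longrightarrow> subspace (K i)"
    and chain: "\<And>i j. i \<in> S \<Longrightarrow> j \<in> S \<Longrightarrow> K i \<subseteq> K j \<or> K j \<subseteq> K i"
  obtains U where "subspace U" "U \<subseteq> W" "U \<noteq> {0}" "\<And>i. i \<in> S \<Longrightarrow> U \<subseteq> K i \<or> K i \<inter> W = {0}"
proof -
  define C where "C = insert W {K i \<inter> W | i. i \<in> S \<and> K i \<inter> W \<noteq> {0}}"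
  obtain U where U: "U \<in> C" "\<And>X. X \<in> C \<Longrightarrow> U \<subseteq> X"
  proof (rule chain_least_subspace[OF \<open>finite B\<close>, of C])
    show "C \<noteq> {}" by (simp add: C_def)
    show "subspace X \<and> X \<subseteq> span B" if "X \<in> C" for X
      using that K assms(2,3) subspace_inter by (auto simp: C_def)
    show "X \<subseteq> Y \<or> Y \<subseteq> X" if "X \<in> C" "Y \<in> C" for X Y
      using that chain unfolding C_def by blast
  qed blast
  have "subspace U" "U \<subseteq> W" "U \<noteq> {0}"
    using U(1) assms(3,4) K subspace_inter by (auto simp: C_def)
  moreover have "U \<subseteq> K i \<or> K i \<inter> W = {0}" if "i \<in> S" for i
    using U(2)[of "K i \<inter> W"] that by (auto simp: C_def)
  ultimately show thesis by (rule that)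
qed

text \<open>This replaces a basis adapted to both flags \<open>K\<close> and \<open>L\<close>: the vector found here can serve as
  a member of such a basis.\<close>

lemma vector_adapted_to_two_chains:
  assumes "finite B" "W \<subseteq> span B" "subspace W" "W \<noteq> {0}"
    and K: "\<And>i. i \<in> S \<Longrightarrow> subspace (K i) \<and> K i \<subseteq> W"
    and Kchain: "\<And>i j. i \<in> S \<Longrightarrow> j \<in> S \<Longrightarrow> K i \<subseteq> K j \<or> K j \<subseteq> K i"
    and L: "\<And>i. i \<in> T \<Longrightarrow> subspace (L i) \<and> L i \<subseteq> W"
    and Lchain: "\<And>i j. i \<in> T \<Longrightarrow> j \<in> T \<Longrightarrow> L i \<subseteq> L j \<or> L j \<subseteq> L i"
  obtains e where "e \<in> W" "e \<noteq> 0"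
    "\<And>i j u v. i \<in> S \<Longrightarrow> j \<in> T \<Longrightarrow> u \<in> K i \<Longrightarrow> v \<in> L j \<Longrightarrow> e = u + v \<Longrightarrow> e \<in> K i \<or> e \<in> L j"
proof -
  obtain U where U: "subspace U" "U \<subseteq> W" "U \<noteq> {0}" "\<And>i. i \<in> S \<Longrightarrow> U \<subseteq> K i \<or> K i \<inter> W = {0}"
    by (rule subspace_in_general_position_wrt_chain[OF assms(1-4), of S K]) (use K Kchain in blast)+
  have "U \<subseteq> span B" using U(2) assms(2) by blast
  then obtain X where X: "subspace X" "X \<subseteq> U" "X \<noteq> {0}" "\<And>j. j \<in> T \<Longrightarrow> X \<subseteq> L j \<or> L j \<inter> U = {0}"
    by (rule subspace_in_general_position_wrt_chain[OF \<open>finite B\<close> _ U(1,3), of T L])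
      (use L Lchain in blast)+
  obtain e where e: "e \<in> X" "e \<noteq> 0" using X(3) subspace_0[OF X(1)] by blast
  then have eW: "e \<in> W" using X(2) U(2) by blast
  have "e \<in> K i \<or> e \<in> L j" if "i \<in> S" "j \<in> T" "u \<in> K i" "v \<in> L j" "e = u + v" for i j u v
  proof (cases "U \<subseteq> K i")
    case True
    then show ?thesis using e X(2) by blast
  next
    case False
    \<comment> \<open>If \<open>K i\<close> does not contain \<open>U\<close>, it meets
      \<open>W\<close> trivially, so the summand \<open>u\<close> is zero and \<open>e\<close> is
      \<open>v\<close>.\<close>
    then have "u = 0" using U(4)[OF that(1)] K[OF that(1)] that(3) by blast
    then show ?thesis using that by simp
  qed
  with eW e(2) show thesis by (rule that)
qed

lemma exists_functional_vanishing_on_subspace: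
  assumes "subspace Z" "g \<notin> Z"
  obtains \<Phi> where "Vector_Spaces.linear scale (*) \<Phi>" "\<Phi> g = 1" "\<And>u. u \<in> Z \<Longrightarrow> \<Phi> u = 0"
proof -
  interpret K: vector_space "(*) :: 'a \<Rightarrow> 'a \<Rightarrow> 'a"
    by unfold_locales (simp_all add: algebra_simps)
  interpret pair: vector_space_pair scale "(*) :: 'a \<Rightarrow> 'a \<Rightarrow> 'a" ..
  obtain A where A: "A \<subseteq> Z" "independent A" "Z \<subseteq> span A"
    using maximal_independent_subset[of Z] by blast
  have "g \<notin> span A" using A(1) assms span_minimal by blast
  then have "independent (insert g A)" using A(2) by (simp add: independent_insert)
  then obtain \<Phi> where \<Phi>: "Vector_Spaces.linear scale (*) \<Phi>"
    "\<And>x. x \<in> insert g A \<Longrightarrow> \<Phi> x = (if x = g then 1 else 0)"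
    using pair.linear_independent_extend[of "insert g A" "\<lambda>x. if x = g then 1 else 0"] by blast
  have "g \<notin> A" using A(1) assms by blast
  then have "\<Phi> u = 0" if "u \<in> A" for u using \<Phi>(2)[of u] that by auto
  then have "\<Phi> u = 0" if "u \<in> Z" for u
    using pair.linear_eq_0_on_span[OF \<Phi>(1), of A u] A(3) that by blast
  then show thesis using that \<Phi> by simp
qed

end

section \<open>Structure maps, their images and kernels\<close>

context vec_functor
begin

lemma f_in: "x \<le> y \<Longrightarrow> v \<in> V x \<Longrightarrow> f x y v \<in> V y"
  using linear_f unfolding linear_between_def by blast

lemma f_add: "x \<le> y \<Longrightarrow> u \<in> V x \<Longrightarrow> v \<in> V x \<Longrightarrow> f x y (u + v) = f x y u + f x y v"
  using linear_f unfolding linear_between_def by blast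

lemma f_scale: "x \<le> y \<Longrightarrow> v \<in> V x \<Longrightarrow> f x y (s c v) = s c (f x y v)"
  using linear_f unfolding linear_between_def by blast

lemma f_0: "x \<le> y \<Longrightarrow> f x y 0 = 0"
  using f_scale[of x y 0 0] subspace_0[OF subspace_V] by simp

lemma f_diff: "x \<le> y \<Longrightarrow> u \<in> V x \<Longrightarrow> v \<in> V x \<Longrightarrow> f x y (u - v) = f x y u - f x y v"
  using f_add[of x y "u - v" v] subspace_diff[OF subspace_V] by simp

lemma f_sum: "x \<le> y \<Longrightarrow> (\<And>i. i \<in> S \<Longrightarrow> g i \<in> V x) \<Longrightarrow> f x y (sum g S) = (\<Sum>i\<in>S. f x y (g i))"
  by (induction S rule: infinite_finite_induct)
    (simp_all add: f_0 f_add subspace_sum[OF subspace_V])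

lemma subspace_image_f:
  assumes "x \<le> y" "subspace U" "U \<subseteq> V x"
  shows "subspace (f x y ` U)"
proof (rule subspaceI)
  show "0 \<in> f x y ` U"
    using f_0[OF assms(1)] subspace_0[OF assms(2)] by (metis imageI)
  show "u + v \<in> f x y ` U" if "u \<in> f x y ` U" "v \<in> f x y ` U" for u v
    using that assms by (auto simp: subset_iff subspace_add simp flip: f_add)
  show "s c u \<in> f x y ` U" if "u \<in> f x y ` U" for c u
    using that assms by (auto simp: subset_iff subspace_scale simp flip: f_scale)
qed

lemma subspace_vimage_f: "x \<le> y \<Longrightarrow> subspace Z \<Longrightarrow> subspace {v \<in> V x. f x y v \<in> Z}"
  by (rule subspaceI) (auto simp: subspace_0 subspace_add subspace_scale f_0 f_add f_scale
      subspace_0[OF subspace_V] subspace_add[OF subspace_V] subspace_scale[OF subspace_V])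

lemma image_f_mono: "x \<le> y \<Longrightarrow> y \<le> z \<Longrightarrow> f x z ` V x \<subseteq> f y z ` V y"
  using f_comp[of x y z] f_in[of x y] by force

lemma kernel_f_mono: "x \<le> y \<Longrightarrow> y \<le> z \<Longrightarrow> {v \<in> V x. f x y v = 0} \<subseteq> {v \<in> V x. f x z v = 0}"
  using f_comp[of x y z] f_0[of y z] by fastforce

lemma subspace_kernel_f: "x \<le> y \<Longrightarrow> subspace {v \<in> V x. f x y v = 0}"
  using subspace_vimage_f[of x y "{0}"] by simp

text \<open>Images arriving along a directed set are themselves directed, so their union absorbs
  sums. Spans of incoming vectors are bounded by such unions later.\<close>

lemma subspace_Union_image_f:
  assumes "S \<noteq> {}" "\<And>x. x \<in> S \<Longrightarrow> x \<le> z"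
    and dir: "\<And>x y. x \<in> S \<Longrightarrow> y \<in> S \<Longrightarrow> \<exists>w\<in>S. x \<le> w \<and> y \<le> w"
  shows "subspace (\<Union>x\<in>S. f x z ` V x)"
proof (rule subspaceI)
  have sub: "subspace (f x z ` V x)" if "x \<in> S" for x
    using subspace_image_f assms(2) that subspace_V by blast
  show "0 \<in> (\<Union>x\<in>S. f x z ` V x)"
  proof -
    obtain x where "x \<in> S" using assms(1) by blast
    then show ?thesis using subspace_0[OF sub] by blast
  qed
  show "s c v \<in> (\<Union>x\<in>S. f x z ` V x)" if v: "v \<in> (\<Union>x\<in>S. f x z ` V x)" for c v
  proof -
    obtain x where x: "x \<in> S" "v \<in> f x z ` V x" using v by (elim UN_E)
    then show ?thesis using subspace_scale[OF sub[OF x(1)] x(2)] by blast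
  qed
  fix u v assume "u \<in> (\<Union>x\<in>S. f x z ` V x)" "v \<in> (\<Union>x\<in>S. f x z ` V x)"
  then obtain x y where xy: "x \<in> S" "u \<in> f x z ` V x" "y \<in> S" "v \<in> f y z ` V y"
    by (elim UN_E)
  obtain w where w: "w \<in> S" "x \<le> w" "y \<le> w" using dir[OF xy(1,3)] by blast
  have "u \<in> f w z ` V w" "v \<in> f w z ` V w"
    using xy(2,4) image_f_mono[OF w(2) assms(2)[OF w(1)]] image_f_mono[OF w(3) assms(2)[OF w(1)]]
    by auto
  then show "u + v \<in> (\<Union>x\<in>S. f x z ` V x)" using w(1) subspace_add[OF sub[OF w(1)]] by blast
qed

text \<open>A linear functional on the colimit of \<open>V\<close> over the directed set \<open>{x. e x \<noteq> 0}\<close>, realised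
  as a quotient of the space of all families of vectors, cuts out the complement.\<close>

lemma section_splits:
  assumes eV: "\<And>x. e x \<in> V x"
    and sec: "\<And>x y. x \<le> y \<Longrightarrow> e x \<noteq> 0 \<Longrightarrow> f x y (e x) = e y"
    and dir: "\<And>x y. e x \<noteq> 0 \<Longrightarrow> e y \<noteq> 0 \<Longrightarrow> \<exists>z. e z \<noteq> 0 \<and> x \<le> z \<and> y \<le> z"
    and out: "\<And>z. e z \<noteq> 0 \<Longrightarrow> e z \<notin> span {f w z v | w v. w \<le> z \<and> e w = 0 \<and> v \<in> V w}"
  obtains N where "\<And>x. subspace (N x)" "\<And>x. N x \<subseteq> V x"
    "\<And>x y. x \<le> y \<Longrightarrow> f x y ` N x \<subseteq> N y"
    "\<And>x. e x \<noteq> 0 \<Longrightarrow> e x \<notin> N x" "\<And>x v. v \<in> V x \<Longrightarrow> \<exists>c. v - s c (e x) \<in> N x"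
proof (cases "\<exists>x. e x \<noteq> 0")
  case False
  then show thesis using that[of V] subspace_V f_in by force
next
  case True
  then obtain x0 where x0: "e x0 \<noteq> 0" by blast
  interpret D: vector_space "dsum_scale s :: 'k \<Rightarrow> ('p \<Rightarrow> 'v) \<Rightarrow> 'p \<Rightarrow> 'v"
    by unfold_locales (auto simp: dsum_scale_def fun_eq_iff scale_right_distrib scale_left_distrib)
  define \<delta> :: "'p \<Rightarrow> 'v \<Rightarrow> 'p \<Rightarrow> 'v" where "\<delta> x v = (\<lambda>y. if y = x then v else 0)" for x v
  define Out where "Out z = {f w z v | w v. w \<le> z \<and> e w = 0 \<and> v \<in> V w}" for z
  \<comment> \<open>The relations of the colimit: a vector is identified with its image inside the
    support, and whatever enters from outside is zero.\<close>
  define U where "U = {\<delta> x v - \<delta> y (f x y v) | x y v. x \<le> y \<and> e x \<noteq> 0 \<and> e y \<noteq> 0 \<and> v \<in> V x}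
    \<union> {\<delta> y (f x y v) | x y v. x \<le> y \<and> e x = 0 \<and> e y \<noteq> 0 \<and> v \<in> V x}"
  \<comment> \<open>An invariant of the span of \<open>U\<close> that \<open>e\<close> violates:
    pushed to any point of the support that is large enough, the family adds up to something
    generated from outside. For \<open>\<delta> x0 (e x0)\<close> that sum is \<open>e z\<close>,
    which \<open>out\<close> excludes. This avoids handling arbitrary combinations of
    relations.\<close>
  define P where "P u \<longleftrightarrow> (\<exists>S z0. finite S \<and> e z0 \<noteq> 0 \<and> (\<forall>x. x \<notin> S \<longrightarrow> u x = 0) \<and>
    (\<forall>x\<in>S. u x \<in> V x \<and> x \<le> z0) \<and>
    (\<forall>z. z0 \<le> z \<longrightarrow> e z \<noteq> 0 \<longrightarrow> (\<Sum>x\<in>S. f x z (u x)) \<in> span (Out z)))" for u :: "'p \<Rightarrow> 'v"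
  have "D.subspace {u. P u}"
  proof (rule D.subspaceI; unfold mem_Collect_eq)
    show "P 0" unfolding P_def by (intro exI[of _ "{}"] exI[of _ x0]) (simp add: x0 span_zero)
  next
    fix u v assume "P u" "P v"
    from \<open>P u\<close> obtain S z where
      u: "finite S" "e z \<noteq> 0" "\<And>x. x \<notin> S \<Longrightarrow> u x = 0" "\<And>x. x \<in> S \<Longrightarrow> u x \<in> V x \<and> x \<le> z"
        "\<And>y. z \<le> y \<Longrightarrow> e y \<noteq> 0 \<Longrightarrow> (\<Sum>x\<in>S. f x y (u x)) \<in> span (Out y)"
      unfolding P_def by blast
    from \<open>P v\<close> obtain S' z' where
      v: "finite S'" "e z' \<noteq> 0" "\<And>x. x \<notin> S' \<Longrightarrow> v x = 0" "\<And>x. x \<in> S' \<Longrightarrow> v x \<in> V x \<and> x \<le> z'"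
        "\<And>y. z' \<le> y \<Longrightarrow> e y \<noteq> 0 \<Longrightarrow> (\<Sum>x\<in>S'. f x y (v x)) \<in> span (Out y)"
      unfolding P_def by blast
    obtain w where w: "e w \<noteq> 0" "z \<le> w" "z' \<le> w" using dir[OF u(2) v(2)] by blast
    have inV: "u x \<in> V x" "v x \<in> V x" for x
      using u(3,4)[of x] v(3,4)[of x] subspace_0[OF subspace_V] by metis+
    have le: "x \<le> w" if "x \<in> S \<union> S'" for x using that u(4) v(4) w by force
    have "(\<Sum>x\<in>S \<union> S'. f x y (u x + v x)) \<in> span (Out y)" if y: "w \<le> y" "e y \<noteq> 0" for y
    proof -
      have ly: "x \<le> y" if "x \<in> S \<union> S'" for x using le[OF that] y by order
      have "(\<Sum>x\<in>S \<union> S'. f x y (u x + v x)) = (\<Sum>x\<in>S \<union> S'. f x y (u x)) + (\<Sum>x\<in>S \<union> S'. f x y (v x))"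
        by (simp add: f_add ly inV flip: sum.distrib)
      also have "(\<Sum>x\<in>S \<union> S'. f x y (u x)) = (\<Sum>x\<in>S. f x y (u x))"
        using u(1,3) v(1) by (intro sum.mono_neutral_right) (auto simp: f_0 ly)
      also have "(\<Sum>x\<in>S \<union> S'. f x y (v x)) = (\<Sum>x\<in>S'. f x y (v x))"
        using v(1,3) u(1) by (intro sum.mono_neutral_right) (auto simp: f_0 ly)
      finally show ?thesis using u(5)[of y] v(5)[of y] y w span_add by fastforce
    qed
    then show "P (u + v)" unfolding P_def
      using u(1,3) v(1,3) w(1) le inV subspace_add[OF subspace_V]
      by (intro exI[of _ "S \<union> S'"] exI[of _ w]) simp
  next
    fix c u assume "P u"
    then obtain S z where
      u: "finite S" "e z \<noteq> 0" "\<And>x. x \<notin> S \<Longrightarrow> u x = 0" "\<And>x. x \<in> S \<Longrightarrow> u x \<in> V x \<and> x \<le> z"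
        "\<And>y. z \<le> y \<Longrightarrow> e y \<noteq> 0 \<Longrightarrow> (\<Sum>x\<in>S. f x y (u x)) \<in> span (Out y)"
      unfolding P_def by blast
    have "(\<Sum>x\<in>S. f x y (s c (u x))) \<in> span (Out y)" if y: "z \<le> y" "e y \<noteq> 0" for y
    proof -
      have "x \<le> y" if "x \<in> S" for x using u(4)[OF that] y by (meson order_trans)
      then have "(\<Sum>x\<in>S. f x y (s c (u x))) = s c (\<Sum>x\<in>S. f x y (u x))"
        using u(4) by (simp add: f_scale scale_sum_right)
      then show ?thesis using u(5)[OF y] by (simp add: span_scale)
    qed
    then show "P (dsum_scale s c u)" unfolding P_def dsum_scale_def
      using u(1-4) subspace_scale[OF subspace_V]
      by (intro exI[of _ S] exI[of _ z]) simp
  qed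
  moreover have "P (\<delta> x v - \<delta> y (f x y v))" if xy: "x \<le> y" "e x \<noteq> 0" "e y \<noteq> 0" "v \<in> V x" for x y v
  \<comment> \<open>For \<open>x = y\<close> the two entries would collapse into one; the family is
    then zero.\<close>
  proof (cases "x = y")
    case True
    then show ?thesis unfolding P_def using xy f_id
      by (intro exI[of _ "{}"] exI[of _ x]) (simp add: \<delta>_def span_zero)
  next
    case False
    have "f x z v + f y z (- f x y v) = 0" if "y \<le> z" for z
      using f_diff[OF that subspace_0[OF subspace_V] f_in[OF xy(1,4)]] f_comp[OF xy(1) that xy(4)]
        f_0[OF that] by simp
    then show ?thesis unfolding P_def
      using xy False f_in[OF xy(1,4)] subspace_neg[OF subspace_V]
      by (intro exI[of _ "{x, y}"] exI[of _ y]) (auto simp: \<delta>_def span_zero)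
  qed
  moreover have "P (\<delta> y (f x y v))" if xy: "x \<le> y" "e x = 0" "e y \<noteq> 0" "v \<in> V x" for x y v
  proof -
    have "f y z (f x y v) \<in> Out z" if "y \<le> z" for z
      unfolding Out_def using xy that f_comp order_trans[OF xy(1) that] by auto
    then show ?thesis unfolding P_def
      using xy f_in[OF xy(1,4)]
      by (intro exI[of _ "{y}"] exI[of _ y]) (auto simp: \<delta>_def intro: span_base)
  qed
  ultimately have span_P: "D.span U \<subseteq> {u. P u}"
    by (intro D.span_minimal) (auto simp: U_def)
  have "\<not> P (\<delta> x0 (e x0))"
  proof
    assume "P (\<delta> x0 (e x0))"
    then obtain S z where
      u: "finite S" "e z \<noteq> 0" "\<And>x. x \<notin> S \<Longrightarrow> \<delta> x0 (e x0) x = 0" "\<And>x. x \<in> S \<Longrightarrow> x \<le> z"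
        "(\<Sum>x\<in>S. f x z (\<delta> x0 (e x0) x)) \<in> span (Out z)"
      unfolding P_def by blast
    have "x0 \<in> S" using u(3)[of x0] x0 by (auto simp: \<delta>_def)
    then have "(\<Sum>x\<in>S. f x z (\<delta> x0 (e x0) x)) = f x0 z (e x0)"
      using u(1,4) by (subst sum.remove) (auto simp: \<delta>_def f_0 intro: sum.neutral)
    also have "\<dots> = e z" using sec u(4) \<open>x0 \<in> S\<close> x0 by blast
    finally show False using u(2,5) out[of z] unfolding Out_def by simp
  qed
  then have "\<delta> x0 (e x0) \<notin> D.span U" using span_P by blast
  then obtain \<Phi> where \<Phi>: "Vector_Spaces.linear (dsum_scale s) (*) \<Phi>" "\<Phi> (\<delta> x0 (e x0)) = 1"
    "\<And>u. u \<in> D.span U \<Longrightarrow> \<Phi> u = 0"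
    using D.exists_functional_vanishing_on_subspace[OF D.subspace_span] by blast
  interpret \<Phi>: Vector_Spaces.linear "dsum_scale s" "(*)" \<Phi> by fact
  define \<phi> where "\<phi> x v = \<Phi> (\<delta> x v)" for x v
  have \<phi>_add: "\<phi> x (u + v) = \<phi> x u + \<phi> x v" for x u v
    unfolding \<phi>_def \<Phi>.add[symmetric] by (rule arg_cong[of _ _ \<Phi>]) (auto simp: \<delta>_def fun_eq_iff)
  have \<phi>_scale: "\<phi> x (s c v) = c * \<phi> x v" for x c v
    unfolding \<phi>_def \<Phi>.scale[symmetric]
    by (rule arg_cong[of _ _ \<Phi>]) (auto simp: \<delta>_def fun_eq_iff dsum_scale_def)
  have \<phi>_diff: "\<phi> x (u - v) = \<phi> x u - \<phi> x v" for x u v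
    using \<phi>_add[of x "u - v" v] by simp
  have \<phi>_f: "\<phi> y (f x y v) = \<phi> x v" if "x \<le> y" "e x \<noteq> 0" "e y \<noteq> 0" "v \<in> V x" for x y v
  proof -
    have "\<delta> x v - \<delta> y (f x y v) \<in> U" unfolding U_def using that by blast
    from \<Phi>(3)[OF D.span_base[OF this]] show ?thesis by (simp add: \<Phi>.diff \<phi>_def)
  qed
  have \<phi>_out: "\<phi> y (f x y v) = 0" if "x \<le> y" "e x = 0" "e y \<noteq> 0" "v \<in> V x" for x y v
  proof -
    have "\<delta> y (f x y v) \<in> U" unfolding U_def using that by blast
    then show ?thesis unfolding \<phi>_def by (intro \<Phi>(3) D.span_base)
  qed
  have \<phi>_e: "\<phi> x (e x) = 1" if x: "e x \<noteq> 0" for x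
  proof -
    obtain z where z: "e z \<noteq> 0" "x0 \<le> z" "x \<le> z" using dir[OF x0 x] by blast
    have "\<phi> x (e x) = \<phi> z (e z)" using \<phi>_f[OF z(3) x z(1) eV] sec[OF z(3) x] by simp
    also have "\<dots> = \<phi> x0 (e x0)" using \<phi>_f[OF z(2) x0 z(1) eV] sec[OF z(2) x0] by simp
    finally show ?thesis using \<Phi>(2) by (simp add: \<phi>_def)
  qed
  \<comment> \<open>There is no condition outside the support. A map entering the support lands in
    the kernel by \<open>\<phi>_out\<close>, and a map within it preserves \<open>\<phi>\<close>, so
    \<open>N\<close> is a subfunctor.\<close>
  define N where "N x = {v \<in> V x. e x \<noteq> 0 \<longrightarrow> \<phi> x v = 0}" for x
  show thesis
  proof (rule that[of N])
    have "\<phi> x 0 = 0" for x using \<phi>_diff[of x 0 0] by simp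
    then show "subspace (N x)" for x
      using subspace_0[OF subspace_V] subspace_add[OF subspace_V] subspace_scale[OF subspace_V]
      by (intro subspaceI) (auto simp: N_def \<phi>_add \<phi>_scale)
    show "N x \<subseteq> V x" for x by (auto simp: N_def)
    show "f x y ` N x \<subseteq> N y" if le: "x \<le> y" for x y
    proof
      fix w assume "w \<in> f x y ` N x"
      then obtain v where v: "w = f x y v" "v \<in> V x" "e x \<noteq> 0 \<longrightarrow> \<phi> x v = 0"
        by (auto simp: N_def)
      then show "w \<in> N y"
        using f_in[OF le v(2)] \<phi>_f[OF le _ _ v(2)] \<phi>_out[OF le _ _ v(2)]
        by (cases "e x = 0") (auto simp: N_def)
    qed
    show "e x \<notin> N x" if "e x \<noteq> 0" for x using that \<phi>_e by (simp add: N_def)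
    show "\<exists>c. v - s c (e x) \<in> N x" if "v \<in> V x" for x v
      using that eV \<phi>_e[of x] subspace_diff[OF subspace_V] subspace_scale[OF subspace_V]
      by (intro exI[of _ "\<phi> x v"]) (auto simp: N_def \<phi>_diff \<phi>_scale)
  qed
qed

end

section \<open>One-parameter functors\<close>

context vec_functor
begin

lemma finite_dim_V:
  assumes "pointwise_finite_dim s V"
  obtains B where "finite B" "span B = V x"
  using assms unfolding pointwise_finite_dim_def by blast

text \<open>The lifts are chosen in the stable images \<open>T n\<close>: by finite dimension each \<open>T n\<close> is a single image,
  so the structure maps are surjective between stable images (the Mittag-Leffler argument).\<close>

lemma lift_along_decseq:
  fixes \<sigma> :: "nat \<Rightarrow> 'p"
  assumes pfd: "pointwise_finite_dim s V" and "decseq \<sigma>"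
    and v: "\<And>n. v \<in> f (\<sigma> n) (\<sigma> 0) ` V (\<sigma> n)"
  obtains a where "a 0 = v" "\<And>n. a n \<in> V (\<sigma> n)" "\<And>n. f (\<sigma> (Suc n)) (\<sigma> n) (a (Suc n)) = a n"
proof -
  have le: "\<sigma> m \<le> \<sigma> n" if "n \<le> m" for m n using \<open>decseq \<sigma>\<close> that by (simp add: decseq_def)
  define T where "T n = (\<Inter>m\<in>{n..}. f (\<sigma> m) (\<sigma> n) ` V (\<sigma> m))" for n
  have surj: "\<exists>y. y \<in> T (Suc n) \<and> f (\<sigma> (Suc n)) (\<sigma> n) y = x" if x: "x \<in> T n" for n x
  proof -
    obtain B where B: "finite B" "span B = V (\<sigma> (Suc n))" using finite_dim_V[OF pfd] .
    define C where "C = (\<lambda>m. f (\<sigma> m) (\<sigma> (Suc n)) ` V (\<sigma> m)) ` {Suc n..}"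
    obtain U where U: "U \<in> C" "\<And>W. W \<in> C \<Longrightarrow> U \<subseteq> W"
    proof (rule chain_least_subspace[OF B(1), of C])
      show "C \<noteq> {}" by (auto simp: C_def)
      show "subspace W \<and> W \<subseteq> span B" if "W \<in> C" for W
        using that subspace_image_f[OF le subspace_V order_refl] f_in[OF le] by (auto simp: C_def B(2))
      show "X \<subseteq> Y \<or> Y \<subseteq> X" if XY: "X \<in> C" "Y \<in> C" for X Y
      proof -
        obtain i j where ij: "X = f (\<sigma> i) (\<sigma> (Suc n)) ` V (\<sigma> i)" "Suc n \<le> i"
          "Y = f (\<sigma> j) (\<sigma> (Suc n)) ` V (\<sigma> j)" "Suc n \<le> j"
          using XY by (auto simp: C_def)
        then show ?thesis
          using image_f_mono[OF le[of i j] le[of "Suc n" i]] image_f_mono[OF le[of j i] le[of "Suc n" j]]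
            linear[of i j] by blast
      qed
    qed blast
    obtain m where m: "Suc n \<le> m" "U = f (\<sigma> m) (\<sigma> (Suc n)) ` V (\<sigma> m)"
      using U(1) by (auto simp: C_def)
    \<comment> \<open>A preimage of \<open>x\<close> at the stage \<open>m\<close> of the least
      image, pushed to stage \<open>Suc n\<close>, lies in every image there, hence in
      \<open>T (Suc n)\<close>.\<close>
    have "x \<in> f (\<sigma> m) (\<sigma> n) ` V (\<sigma> m)" using x m(1) by (auto simp: T_def)
    then obtain w where w: "w \<in> V (\<sigma> m)" "x = f (\<sigma> m) (\<sigma> n) w" by (elim imageE)
    have "f (\<sigma> m) (\<sigma> (Suc n)) w \<in> W" if "W \<in> C" for W using U(2)[OF that] m(2) w(1) by auto
    then have "f (\<sigma> m) (\<sigma> (Suc n)) w \<in> T (Suc n)" by (auto simp: T_def C_def)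
    moreover have "f (\<sigma> (Suc n)) (\<sigma> n) (f (\<sigma> m) (\<sigma> (Suc n)) w) = x"
      using f_comp[OF le[OF m(1)] le[of n "Suc n"] w(1)] w(2) by simp
    ultimately show ?thesis by blast
  qed
  have "\<exists>a. \<forall>n. (a n \<in> T n \<and> (n = 0 \<longrightarrow> a n = v)) \<and> f (\<sigma> (Suc n)) (\<sigma> n) (a (Suc n)) = a n"
    using v surj by (intro dependent_nat_choice) (auto simp: T_def)
  then obtain a where a: "\<And>n. a n \<in> T n" "a 0 = v" "\<And>n. f (\<sigma> (Suc n)) (\<sigma> n) (a (Suc n)) = a n"
    by blast
  have "a n \<in> V (\<sigma> n)" for n
  proof -
    have "a n \<in> f (\<sigma> n) (\<sigma> n) ` V (\<sigma> n)" using a(1)[of n] by (auto simp: T_def)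
    then show ?thesis using f_in[OF order_refl] by auto
  qed
  with a(2) show thesis using a(3) by (rule that)
qed

lemma kernels_chain:
  fixes t :: "'p"
  assumes "t \<le> x" "t \<le> y" "x \<le> y \<or> y \<le> x"
  shows "{v \<in> V t. f t x v = 0} \<subseteq> {v \<in> V t. f t y v = 0} \<or> {v \<in> V t. f t y v = 0} \<subseteq> {v \<in> V t. f t x v = 0}"
  using assms kernel_f_mono[of t x y] kernel_f_mono[of t y x] by argo

lemma images_chain:
  fixes t :: "'p"
  assumes "x \<le> t" "y \<le> t" "x \<le> y \<or> y \<le> x"
  shows "f x t ` V x \<subseteq> f y t ` V y \<or> f y t ` V y \<subseteq> f x t ` V x"
  using assms image_f_mono[of x y t] image_f_mono[of y x t] by argo

end

text \<open>The Mittag-Leffler argument runs along a sequence. If the infimum is attained, it serves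
  as a constant sequence; otherwise a sequence decreasing to it eventually drops below each element
  of \<open>D\<close>.\<close>

lemma exists_coinitial_decseq:
  fixes D :: "ennreal set"
  assumes "t \<in> D" "\<And>s. s \<in> D \<Longrightarrow> s \<le> t"
  obtains \<sigma> :: "nat \<Rightarrow> ennreal" where "decseq \<sigma>" "range \<sigma> \<subseteq> D" "\<sigma> 0 = t" "\<And>s. s \<in> D \<Longrightarrow> \<exists>n. \<sigma> n \<le> s"
proof -
  obtain \<tau> where \<tau>: "decseq \<tau>" "range \<tau> \<subseteq> D" "\<And>s. s \<in> D \<Longrightarrow> \<exists>n. \<tau> n \<le> s"
  proof (cases "Inf D \<in> D")
    case True
    then show thesis using that[of "\<lambda>_. Inf D"] by (auto simp: decseq_def Inf_lower)
  next
    case False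
    obtain \<tau> where \<tau>: "decseq \<tau>" "range \<tau> \<subseteq> D" "Inf D = (INF i. \<tau> i)"
      using ennreal_Inf_countable_INF[of D] assms(1) by blast
    have "\<exists>n. \<tau> n \<le> s" if "s \<in> D" for s
    proof -
      have "Inf D < s" using that False Inf_lower[OF that] by (metis order_le_less)
      then show ?thesis unfolding \<tau>(3) INF_less_iff by (auto intro: less_imp_le)
    qed
    with \<tau>(1,2) show thesis by (rule that)
  qed
  \<comment> \<open>Prepending the largest element \<open>t\<close> keeps the sequence decreasing
    and makes the lift start at \<open>t\<close>.\<close>
  define \<sigma> where "\<sigma> n = (case n of 0 \<Rightarrow> t | Suc m \<Rightarrow> \<tau> m)" for n
  show thesis
  proof (rule that[of \<sigma>])
    show "decseq \<sigma>" using \<tau>(1,2) assms(2)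
      by (intro decseq_SucI) (auto simp: \<sigma>_def decseq_Suc_iff split: nat.split)
    show "range \<sigma> \<subseteq> D" using \<tau>(2) assms(1) by (force simp: \<sigma>_def split: nat.split)
    show "\<exists>n. \<sigma> n \<le> s" if s: "s \<in> D" for s
    proof -
      obtain n where "\<tau> n \<le> s" using \<tau>(3)[OF s] by blast
      then have "\<sigma> (Suc n) \<le> s" by (simp add: \<sigma>_def)
      then show ?thesis by blast
    qed
  qed (simp add: \<sigma>_def)
qed

text \<open>A lift along a coinitial sequence determines values on all of \<open>D\<close>, by
  pushing forward from any \<open>\<sigma> n\<close> below the point; compatibility of the lift
  makes the result independent of \<open>n\<close>.\<close>

lemma lift_section:
  fixes V :: "ennreal \<Rightarrow> 'v::ab_group_add set" and s :: "'k::field \<Rightarrow> 'v \<Rightarrow> 'v"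
  assumes "vec_functor s V f" and pfd: "pointwise_finite_dim s V"
    and "t \<in> D" and D: "\<And>x. x \<in> D \<Longrightarrow> x \<le> t \<and> v \<in> f x t ` V x"
  obtains a where "a t = v" "\<And>x. x \<in> D \<Longrightarrow> a x \<in> V x"
    "\<And>x y. x \<in> D \<Longrightarrow> y \<in> D \<Longrightarrow> x \<le> y \<Longrightarrow> f x y (a x) = a y"
proof -
  interpret vec_functor s V f by fact
  obtain \<sigma> :: "nat \<Rightarrow> ennreal" where \<sigma>: "decseq \<sigma>" "range \<sigma> \<subseteq> D" "\<sigma> 0 = t" "\<And>x. x \<in> D \<Longrightarrow> \<exists>n. \<sigma> n \<le> x"
    using exists_coinitial_decseq[of t D] assms(3) D by blast
  have le: "\<sigma> m \<le> \<sigma> n" if "n \<le> m" for m n using \<sigma>(1) that by (simp add: decseq_def)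
  obtain b where b: "b 0 = v" "\<And>n. b n \<in> V (\<sigma> n)" "\<And>n. f (\<sigma> (Suc n)) (\<sigma> n) (b (Suc n)) = b n"
    by (rule lift_along_decseq[OF pfd \<sigma>(1), of v]) (use \<sigma>(2,3) D in blast)+
  have b': "f (\<sigma> m) (\<sigma> n) (b m) = b n" if "n \<le> m" for m n
    using that
  proof (induction rule: dec_induct)
    case base
    show ?case using f_id[OF b(2)] .
  next
    case (step m)
    have "f (\<sigma> (Suc m)) (\<sigma> n) (b (Suc m)) = f (\<sigma> m) (\<sigma> n) (f (\<sigma> (Suc m)) (\<sigma> m) (b (Suc m)))"
      using f_comp[OF le[of m "Suc m"] le[OF step(1)] b(2)] by simp
    then show ?case using b(3) step by simp
  qed
  define a where "a x = f (\<sigma> (LEAST n. \<sigma> n \<le> x)) x (b (LEAST n. \<sigma> n \<le> x))" for x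
  have a: "a x = f (\<sigma> n) x (b n)" if "\<sigma> n \<le> x" for n x
  proof -
    define m where "m = (LEAST n. \<sigma> n \<le> x)"
    have m: "\<sigma> m \<le> x" "m \<le> n"
      unfolding m_def using that by (auto intro: LeastI2 Least_le)
    have "f (\<sigma> n) x (b n) = f (\<sigma> m) x (f (\<sigma> n) (\<sigma> m) (b n))"
      using f_comp[OF le[OF m(2)] m(1) b(2)] by simp
    then show ?thesis unfolding a_def m_def[symmetric] using b'[OF m(2)] by simp
  qed
  show thesis
  proof (rule that[of a])
    show "a t = v" using a[of 0 t] \<sigma>(3) b(1) b(2)[of 0] f_id by simp
    show "a x \<in> V x" if "x \<in> D" for x using \<sigma>(4)[OF that] a b(2) f_in by metis
    show "f x y (a x) = a y" if xy: "x \<in> D" "y \<in> D" "x \<le> y" for x y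
    proof -
      obtain n where n: "\<sigma> n \<le> x" using \<sigma>(4)[OF xy(1)] by blast
      then show ?thesis using a[OF n] a[of n y] f_comp[OF n xy(3) b(2)] xy(3) by simp
    qed
  qed
qed

text \<open>Adaptedness matters where a vector enters from outside the support at some
  \<open>x\<close> below \<open>t\<close> and reaches the value of the section only at some
  \<open>y\<close> above \<open>t\<close>. Excluding single images is enough, since on a chain
  images are nested and their union is already a subspace.\<close>

lemma exists_section_one_parameter:
  fixes V :: "ennreal \<Rightarrow> 'v::ab_group_add set" and s :: "'k::field \<Rightarrow> 'v \<Rightarrow> 'v"
  assumes "vec_functor s V f" and pfd: "pointwise_finite_dim s V" and "V t \<noteq> {0}"
  obtains c where "c t \<noteq> 0" "\<And>x. c x \<in> V x"
    "\<And>x y. x \<le> y \<Longrightarrow> c x \<noteq> 0 \<Longrightarrow> f x y (c x) = c y"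
    "\<And>x y. x \<le> y \<Longrightarrow> c x = 0 \<Longrightarrow> c y \<noteq> 0 \<Longrightarrow> c y \<notin> f x y ` V x"
proof -
  interpret vec_functor s V f by fact
  define K where "K u = {v \<in> V t. f t u v = 0}" for u
  define L where "L u = f u t ` V u" for u
  obtain B where B: "finite B" "span B = V t" using finite_dim_V[OF pfd] .
  have K: "subspace (K u) \<and> K u \<subseteq> V t" if "u \<in> {t..}" for u
    using that subspace_kernel_f by (auto simp: K_def)
  have L: "subspace (L u) \<and> L u \<subseteq> V t" if "u \<in> {..t}" for u
    using that subspace_image_f[OF _ subspace_V order_refl] f_in by (auto simp: L_def)
  obtain e where e: "e \<in> V t" "e \<noteq> 0"
    "\<And>i j u v. i \<in> {t..} \<Longrightarrow> j \<in> {..t} \<Longrightarrow> u \<in> K i \<Longrightarrow> v \<in> L j \<Longrightarrow> e = u + v \<Longrightarrow> e \<in> K i \<or> e \<in> L j"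
  proof (rule vector_adapted_to_two_chains[OF B(1) _ subspace_V assms(3) K _ L])
    show "V t \<subseteq> span B" using B by simp
    show "K i \<subseteq> K j \<or> K j \<subseteq> K i" if "i \<in> {t..}" "j \<in> {t..}" for i j
      using kernels_chain[of t i j] that linear unfolding K_def by auto
    show "L i \<subseteq> L j \<or> L j \<subseteq> L i" if "i \<in> {..t}" "j \<in> {..t}" for i j
      using images_chain[of i t j] that linear unfolding L_def by auto
  qed blast+
  define D where "D = {x. x \<le> t \<and> e \<in> L x}"
  have "t \<in> D" using e(1) f_id[OF e(1)] by (force simp: D_def L_def)
  obtain a where a: "a t = e" "\<And>x. x \<in> D \<Longrightarrow> a x \<in> V x"
    "\<And>x y. x \<in> D \<Longrightarrow> y \<in> D \<Longrightarrow> x \<le> y \<Longrightarrow> f x y (a x) = a y"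
    by (rule lift_section[OF assms(1) pfd \<open>t \<in> D\<close>, of e]) (auto simp: D_def L_def)
  have D_up: "y \<in> D" if "x \<in> D" "x \<le> y" "y \<le> t" for x y
    using that image_f_mono[OF that(2,3)] by (auto simp: D_def L_def)
  define c where "c u = (if u \<le> t then if u \<in> D then a u else 0 else f t u e)" for u
  have f_a: "f x t (a x) = e" if "x \<in> D" for x
    using a(3)[OF that \<open>t \<in> D\<close>] a(1) that by (simp add: D_def)
  have a0: "a x \<noteq> 0" if "x \<in> D" for x
    using f_a[OF that] f_0[of x t] e(2) that by (auto simp: D_def)
  \<comment> \<open>At \<open>u = t\<close> both branches of \<open>c\<close> agree, because
    \<open>a t = e\<close>.\<close>
  have c_ge: "c u = f t u e" if "t \<le> u" for u
    using that \<open>t \<in> D\<close> f_id[OF e(1)] a(1) by (cases "u = t") (auto simp: c_def)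
  have sec: "f x y (c x) = c y" if xy: "x \<le> y" "c x \<noteq> 0" for x y
  proof (cases "x \<le> t")
    case True
    then have x: "x \<in> D" "c x = a x" using xy(2) by (auto simp: c_def split: if_splits)
    show ?thesis
    proof (cases "y \<le> t")
      case True
      then show ?thesis using a(3)[OF x(1) _ xy(1)] D_up[OF x(1) xy(1)] x(2) by (simp add: c_def)
    next
      case False
      then show ?thesis using f_comp[OF True _ a(2)[OF x(1)], of y] f_a[OF x(1)] x(2) c_ge[of y] by simp
    qed
  next
    case False
    then show ?thesis using f_comp[OF _ xy(1) e(1)] c_ge[of x] c_ge[of y] xy(1) by simp
  qed
  have not_image: "c y \<notin> f x y ` V x" if xy: "x \<le> y" "c x = 0" "c y \<noteq> 0" for x y
  proof
    assume "c y \<in> f x y ` V x"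
    then obtain z where z: "c y = f x y z" "z \<in> V x" by (elim imageE)
    have xt: "x \<le> t" "e \<notin> L x"
    proof -
      show *: "x \<le> t"
      proof (rule ccontr)
        assume "\<not> x \<le> t"
        then have "t \<le> x" by simp
        then have "c y = 0"
          using c_ge[of x] c_ge[of y] f_comp[OF _ xy(1) e(1)] f_0[OF xy(1)] xy(1,2) by simp
        then show False using xy(3) by simp
      qed
      show "e \<notin> L x" using * xy(2) a0 by (auto simp: c_def D_def)
    qed
    show False
    proof (cases "y \<le> t")
      case True
      then have y: "y \<in> D" "c y = a y" using xy(3) by (auto simp: c_def split: if_splits)
      have "f x t z = e" using f_comp[OF xy(1) True z(2)] z(1) y f_a[OF y(1)] by simp
      then show False using xt z(2) by (auto simp: L_def)
    next
      case False
      then have ty: "t \<le> y" by simp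
      have fz: "f x t z \<in> L x" "f x t z \<in> V t" using z(2) f_in[OF xt(1)] by (auto simp: L_def)
      have "f t y (e - f x t z) = 0"
        using f_diff[OF ty e(1) fz(2)] f_comp[OF xt(1) ty z(2)] z(1) c_ge[OF ty] by simp
      \<comment> \<open>\<open>e\<close> is a sum of a vector dying at \<open>y\<close> and one
        coming from \<open>x\<close>. Adaptedness makes \<open>e\<close> itself die at
        \<open>y\<close> or come from \<open>x\<close>, and both are excluded.\<close>
      then have "e - f x t z \<in> K y" using subspace_diff[OF subspace_V e(1) fz(2)] by (simp add: K_def)
      then have "e \<in> K y \<or> e \<in> L x" using e(3)[of y x "e - f x t z" "f x t z"] ty xt(1) fz(1) by simp
      then show False using xt(2) c_ge[OF ty] xy(3) by (simp add: K_def)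
    qed
  qed
  show thesis
  proof (rule that[of c])
    show "c t \<noteq> 0" using c_ge[of t] f_id[OF e(1)] e(2) by simp
    show "c x \<in> V x" for x
      using a(2) f_in[OF _ e(1)] subspace_0[OF subspace_V] by (auto simp: c_def)
  qed (use sec not_image in auto)
qed

section \<open>Sections over blocks\<close>

text \<open>The span in the last clause is what a functional killing all vectors from outside the
  support requires. Directedness of the support, also a hypothesis of \<open>section_splits\<close>,
  will come from \<open>block\<close>.\<close>

definition splitting_section ::
  "('k::field \<Rightarrow> 'v::ab_group_add \<Rightarrow> 'v) \<Rightarrow> ('p::order \<Rightarrow> 'v set) \<Rightarrow> ('p \<Rightarrow> 'p \<Rightarrow> 'v \<Rightarrow> 'v) \<Rightarrow>
   ('p \<Rightarrow> 'v) \<Rightarrow> bool" where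
  "splitting_section s V f e \<longleftrightarrow>
     (\<forall>x. e x \<in> V x) \<and> (\<exists>x. e x \<noteq> 0) \<and>
     (\<forall>x y. x \<le> y \<longrightarrow> e x \<noteq> 0 \<longrightarrow> f x y (e x) = e y) \<and>
     (\<forall>z. e z \<noteq> 0 \<longrightarrow> e z \<notin> module.span s {f w z v | w v. w \<le> z \<and> e w = 0 \<and> v \<in> V w})"

lemma splitting_sectionD:
  assumes "splitting_section s V f e"
  shows "e x \<in> V x" "\<exists>x. e x \<noteq> 0" "x \<le> y \<Longrightarrow> e x \<noteq> 0 \<Longrightarrow> f x y (e x) = e y"
    "e z \<noteq> 0 \<Longrightarrow> e z \<notin> module.span s {f w z v | w v. w \<le> z \<and> e w = 0 \<and> v \<in> V w}"
  using assms by (simp_all add: splitting_section_def)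

lemma (in vec_functor) support_convex:
  assumes "splitting_section s V f e" "x \<le> y" "y \<le> z" "e x \<noteq> 0" "e z \<noteq> 0"
  shows "e y \<noteq> 0"
proof
  assume "e y = 0"
  have e: "e x \<in> V x" "f x y (e x) = e y" "f x z (e x) = e z"
    using assms order_trans[OF assms(2,3)] by (auto simp: splitting_section_def)
  then have "e z = 0" using f_comp[OF assms(2,3) e(1)] f_0[OF assms(3)] \<open>e y = 0\<close> by simp
  with assms(5) show False ..
qed

lemma poset_interval_directed:
  assumes "\<And>x y z. x \<in> I \<Longrightarrow> y \<in> I \<Longrightarrow> x \<le> z \<Longrightarrow> z \<le> y \<Longrightarrow> z \<in> I"
    and "\<And>x y. x \<in> I \<Longrightarrow> y \<in> I \<Longrightarrow> \<exists>z\<in>I. x \<le> z \<and> y \<le> z"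
  shows "poset_interval I"
  unfolding poset_interval_def
proof (intro conjI ballI)
  fix x y assume xy: "x \<in> I" "y \<in> I"
  then obtain z where z: "z \<in> I" "x \<le> z" "y \<le> z" using assms(2) by blast
  \<comment> \<open>A common upper bound \<open>z\<close> gives the zigzag
    \<open>x \<le> z \<ge> y \<le> y\<close>, with \<open>n = 1\<close>.\<close>
  show "\<exists>n a b. a 0 = x \<and> b n = y \<and> (\<forall>i\<le>n. a i \<in> I \<and> b i \<in> I \<and> a i \<le> b i) \<and> (\<forall>i<n. a (Suc i) \<le> b i)"
    using xy z
    by (intro exI[of _ 1] exI[of _ "\<lambda>i. if i = 0 then x else y"] exI[of _ "\<lambda>i. if i = 0 then z else y"])
      auto
qed (use assms(1) in blast)

lemma poset_interval_linorder:
  fixes J :: "'a::linorder set"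
  assumes "\<And>x y z. x \<in> J \<Longrightarrow> y \<in> J \<Longrightarrow> x \<le> z \<Longrightarrow> z \<le> y \<Longrightarrow> z \<in> J"
  shows "poset_interval J"
  using assms
proof (rule poset_interval_directed)
  show "\<exists>z\<in>J. x \<le> z \<and> y \<le> z" if "x \<in> J" "y \<in> J" for x y
    using that by (cases x y rule: le_cases) auto
qed

lemma directed_mono_image:
  fixes J :: "'a::linorder set" and h :: "'a \<Rightarrow> 'b::order"
  assumes "mono h" "x \<in> h ` J" "y \<in> h ` J"
  shows "\<exists>w\<in>h ` J. x \<le> w \<and> y \<le> w"
proof -
  obtain i j where ij: "x = h i" "y = h j" "i \<in> J" "j \<in> J" using assms(2,3) by blast
  then have "max i j \<in> J" by (simp add: max_def)
  moreover have "x \<le> h (max i j)" "y \<le> h (max i j)" using monoD[OF assms(1)] ij by simp_all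
  ultimately show ?thesis by blast
qed

lemma rectangle_directed:
  fixes J1 :: "'a::linorder set" and J2 :: "'b::linorder set"
  assumes "x \<in> J1 \<times> J2" "y \<in> J1 \<times> J2"
  shows "\<exists>z\<in>J1 \<times> J2. x \<le> z \<and> y \<le> z"
proof -
  have "(max (fst x) (fst y), max (snd x) (snd y)) \<in> J1 \<times> J2"
    using assms by (auto simp: max_def)
  then show ?thesis by (rule rev_bexI) (auto simp: less_eq_prod_def)
qed

text \<open>Each of the four kinds is a product of subsets of chains, in which coordinatewise maxima
  stay. This supplies the directedness that \<open>section_splits\<close> asks for.\<close>

lemma block_directed: "block I \<Longrightarrow> x \<in> I \<Longrightarrow> y \<in> I \<Longrightarrow> \<exists>z\<in>I. x \<le> z \<and> y \<le> z"
  unfolding block_def death_block_def birth_block_def vertical_block_def horizontal_block_def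
  by (elim conjE disjE exE) (simp_all only: rectangle_directed)

lemma (in vec_functor) poset_interval_support:
  assumes "splitting_section s V f e"
    and "\<And>x y. e x \<noteq> 0 \<Longrightarrow> e y \<noteq> 0 \<Longrightarrow> \<exists>z. e z \<noteq> 0 \<and> x \<le> z \<and> y \<le> z"
  shows "poset_interval {x. e x \<noteq> 0}"
  using assms(2) support_convex[OF assms(1)] by (intro poset_interval_directed) auto

text \<open>Middle exactness on the rectangle with corners \<open>(a, b)\<close> and
  \<open>(c, d)\<close>, stated for elements and as the inclusion that functoriality does not give.
  In this form it is easily checked on a remainder and is symmetric under exchanging the
  coordinates.\<close>

locale rectangle_exact_functor = vec_functor s V f
  for s :: "'k::field \<Rightarrow> 'v::ab_group_add \<Rightarrow> 'v" and V :: "ennreal \<times> ennreal \<Rightarrow> 'v set" and f +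
  assumes pfd: "pointwise_finite_dim s V"
    and rectangle_exact: "a \<le> c \<Longrightarrow> b \<le> d \<Longrightarrow> p \<in> V (c, b) \<Longrightarrow> q \<in> V (a, d) \<Longrightarrow>
      f (c, b) (c, d) p = f (a, d) (c, d) q \<Longrightarrow>
      \<exists>v\<in>V (a, b). f (a, b) (c, b) v = p \<and> f (a, b) (a, d) v = q"
begin

lemma block_rectangle_support:
  assumes "splitting_section s V f e" "{x. e x \<noteq> 0} = J1 \<times> J2"
  shows "poset_interval {x. e x \<noteq> 0}"
  using poset_interval_support[OF assms(1)] rectangle_directed[of _ J1 J2] assms(2)[symmetric]
  by blast

text \<open>By exactness the kernel of the map to \<open>V (a, b)\<close> is
  \<open>K a + L b\<close>. For an adapted \<open>e\<close>, dying at \<open>(a, b)\<close>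
  therefore means dying at \<open>(a, 0)\<close> or at \<open>(0, b)\<close>.\<close>

lemma death_section:
  assumes "V (0, 0) \<noteq> {0}"
  obtains e where "splitting_section s V f e" "block {x. e x \<noteq> 0}"
proof -
  define K where "K a = {v \<in> V (0, 0). f (0, 0) (a, 0) v = 0}" for a
  define L where "L b = {v \<in> V (0, 0). f (0, 0) (0, b) v = 0}" for b
  obtain B where B: "finite B" "span B = V (0, 0)" using finite_dim_V[OF pfd] .
  obtain e where e: "e \<in> V (0, 0)" "e \<noteq> 0"
    "\<And>i j u v. i \<in> UNIV \<Longrightarrow> j \<in> UNIV \<Longrightarrow> u \<in> K i \<Longrightarrow> v \<in> L j \<Longrightarrow> e = u + v \<Longrightarrow> e \<in> K i \<or> e \<in> L j"
  proof (rule vector_adapted_to_two_chains[OF B(1) _ subspace_V assms, of UNIV K UNIV L])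
    show "V (0, 0) \<subseteq> span B" using B by simp
    show "subspace (K i) \<and> K i \<subseteq> V (0, 0)" for i using subspace_kernel_f by (auto simp: K_def)
    show "subspace (L i) \<and> L i \<subseteq> V (0, 0)" for i using subspace_kernel_f by (auto simp: L_def)
    show "K i \<subseteq> K j \<or> K j \<subseteq> K i" for i j
      using kernels_chain[of "(0, 0)" "(i, 0)" "(j, 0)"] linear unfolding K_def by auto
    show "L i \<subseteq> L j \<or> L j \<subseteq> L i" for i j
      using kernels_chain[of "(0, 0)" "(0, i)" "(0, j)"] linear unfolding L_def by auto
  qed blast
  define g where "g x = f (0, 0) x e" for x
  have le: "(0, 0) \<le> x" for x :: "ennreal \<times> ennreal" by (simp add: less_eq_prod_def)
  have g: "f x y (g x) = g y" if "x \<le> y" for x y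
    using f_comp[OF le that e(1)] by (simp add: g_def)
  have gV: "g x \<in> V x" for x using f_in[OF le e(1)] by (simp add: g_def)
  have g0: "g (a, b) = 0 \<longleftrightarrow> e \<in> K a \<or> e \<in> L b" for a b
  proof
    assume *: "g (a, b) = 0"
    \<comment> \<open>Exactness for the pair \<open>(g (a, 0), 0)\<close> yields a vector
      \<open>u\<close> that agrees with \<open>e\<close> at \<open>(a, 0)\<close> and dies at
      \<open>(0, b)\<close>.\<close>
    have "f (a, 0) (a, b) (g (a, 0)) = f (0, b) (a, b) 0"
      using * g[of "(a, 0)" "(a, b)"] f_0[of "(0, b)" "(a, b)"] by simp
    then obtain u where u: "u \<in> V (0, 0)" "f (0, 0) (a, 0) u = g (a, 0)" "f (0, 0) (0, b) u = 0"
      using rectangle_exact[of 0 a 0 b "g (a, 0)" 0] gV subspace_0[OF subspace_V] by auto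
    have "e - u \<in> K a" "u \<in> L b"
      using u f_diff[OF le e(1) u(1)] subspace_diff[OF subspace_V e(1) u(1)]
      by (auto simp: K_def L_def g_def)
    then show "e \<in> K a \<or> e \<in> L b" using e(3)[of a b "e - u" u] by simp
  next
    assume "e \<in> K a \<or> e \<in> L b"
    then show "g (a, b) = 0"
      using g[of "(a, 0)" "(a, b)"] g[of "(0, b)" "(a, b)"]
        f_0[of "(a, 0)" "(a, b)"] f_0[of "(0, b)" "(a, b)"] by (auto simp: K_def L_def g_def)
  qed
  have "splitting_section s V f g"
    unfolding splitting_section_def
  proof (intro conjI allI impI)
    show "\<exists>x. g x \<noteq> 0" using f_id[OF e(1)] e(2) unfolding g_def by metis
    show "g z \<notin> span {f w z v | w v. w \<le> z \<and> g w = 0 \<and> v \<in> V w}" if "g z \<noteq> 0" for z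
    proof -
      \<comment> \<open>The support is down-closed: no point below \<open>z\<close> lies outside of
        it, so the span is zero.\<close>
      have "g w \<noteq> 0" if "w \<le> z" for w using g[OF that] f_0[OF that] \<open>g z \<noteq> 0\<close> by auto
      then have "{f w z v | w v. w \<le> z \<and> g w = 0 \<and> v \<in> V w} = {}" by blast
      then show ?thesis using that unfolding \<open>_ = {}\<close> by simp
    qed
  qed (use gV g in auto)
  moreover have supp: "{x. g x \<noteq> 0} = {a. e \<notin> K a} \<times> {b. e \<notin> L b}"
    using g0 by auto
  moreover have "K i \<subseteq> K j" "L i \<subseteq> L j" if "i \<le> j" for i j
    using kernel_f_mono[of "(0, 0)" "(i, 0)" "(j, 0)"] kernel_f_mono[of "(0, 0)" "(0, i)" "(0, j)"] that
    by (simp_all add: K_def L_def)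
  then have "down_closed {a. e \<notin> K a}" "down_closed {b. e \<notin> L b}"
    unfolding down_closed_def by blast+
  ultimately show thesis
    using block_rectangle_support that unfolding block_def death_block_def by blast
qed

text \<open>With injective maps every \<open>V (a, b)\<close> embeds in \<open>V (top, top)\<close>,
  and exactness identifies it with the intersection of \<open>K a\<close> and
  \<open>L b\<close>.\<close>

lemma birth_section:
  assumes zero: "\<And>a. V (a, 0) = {0}" "\<And>b. V (0, b) = {0}" and "V x \<noteq> {0}"
  obtains e where "splitting_section s V f e" "block {x. e x \<noteq> 0}"
proof -
  have le: "x \<le> (top, top)" for x :: "ennreal \<times> ennreal" by (simp add: less_eq_prod_def)
  \<comment> \<open>A rectangle with its lower side on the axis: a vector that dies in the
    horizontal direction comes from \<open>V (a, 0)\<close>, which is zero.\<close>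
  have inj1: "v = 0" if v: "v \<in> V (a, b)" "f (a, b) (c, b) v = 0" and "a \<le> c" for a b c v
  proof -
    have "\<exists>u\<in>V (a, 0). f (a, 0) (c, 0) u = 0 \<and> f (a, 0) (a, b) u = v"
      using v \<open>a \<le> c\<close> f_0[of "(c, 0)" "(c, b)"] subspace_0[OF subspace_V]
      by (intro rectangle_exact) auto
    then show ?thesis using zero(1) f_0[of "(a, 0)" "(a, b)"] by auto
  qed
  have inj2: "v = 0" if v: "v \<in> V (a, b)" "f (a, b) (a, d) v = 0" and "b \<le> d" for a b d v
  proof -
    have "\<exists>u\<in>V (0, b). f (0, b) (a, b) u = v \<and> f (0, b) (0, d) u = 0"
      using v \<open>b \<le> d\<close> f_0[of "(0, d)" "(a, d)"] subspace_0[OF subspace_V]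
      by (intro rectangle_exact) auto
    then show ?thesis using zero(2) f_0[of "(0, b)" "(a, b)"] by auto
  qed
  have inj0: "v = 0" if v: "v \<in> V x" "f x (top, top) v = 0" for x v
  proof -
    obtain a b where x: "x = (a, b)" by (cases x)
    have "f (a, b) (top, b) v \<in> V (top, b)" "f (top, b) (top, top) (f (a, b) (top, b) v) = 0"
      using v f_comp[of "(a, b)" "(top, b)" "(top, top)" v] f_in[of "(a, b)" "(top, b)" v]
      by (simp_all add: x)
    from inj2[OF this top_greatest] inj1[of v a b top] v show ?thesis by (simp add: x)
  qed
  have inj: "u = v" if "u \<in> V x" "v \<in> V x" "f x (top, top) u = f x (top, top) v" for x u v
    using inj0[of "u - v" x] that f_diff[OF le] subspace_diff[OF subspace_V] by simp
  define W where "W = V (top, top)"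
  obtain v0 where "v0 \<in> V x" "v0 \<noteq> 0" using assms(3) subspace_0[OF subspace_V] by blast
  then have "f x (top, top) v0 \<in> W" "f x (top, top) v0 \<noteq> 0"
    using inj0[of v0 x] f_in[OF le[of x]] by (auto simp: W_def)
  then have W0: "W \<noteq> {0}" by blast
  define K where "K a = f (a, top) (top, top) ` V (a, top)" for a
  define L where "L b = f (top, b) (top, top) ` V (top, b)" for b
  obtain B where B: "finite B" "span B = W" using finite_dim_V[OF pfd] unfolding W_def .
  have K: "subspace (K i)" "K i \<subseteq> W" for i
    using subspace_image_f[OF le subspace_V order_refl] f_in[OF le] by (auto simp: K_def W_def)
  have L: "subspace (L i)" "L i \<subseteq> W" for i
    using subspace_image_f[OF le subspace_V order_refl] f_in[OF le] by (auto simp: L_def W_def)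
  have subW: "subspace W" using subspace_V by (simp add: W_def)
  have K_mono: "K i \<subseteq> K j" if "i \<le> j" for i j
    using image_f_mono[of "(i, top)" "(j, top)" "(top, top)"] that by (simp add: K_def)
  have L_mono: "L i \<subseteq> L j" if "i \<le> j" for i j
    using image_f_mono[of "(top, i)" "(top, j)" "(top, top)"] that by (simp add: L_def)
  obtain e where e: "e \<in> W" "e \<noteq> 0"
    "\<And>i j u v. i \<in> UNIV \<Longrightarrow> j \<in> UNIV \<Longrightarrow> u \<in> K i \<Longrightarrow> v \<in> L j \<Longrightarrow> e = u + v \<Longrightarrow> e \<in> K i \<or> e \<in> L j"
  proof (rule vector_adapted_to_two_chains[OF B(1) _ subW W0, of UNIV K UNIV L])
    show "W \<subseteq> span B" using B by simp
    show "K i \<subseteq> K j \<or> K j \<subseteq> K i" for i j using K_mono[of i j] K_mono[of j i] linear[of i j] by argo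
    show "L i \<subseteq> L j \<or> L j \<subseteq> L i" for i j using L_mono[of i j] L_mono[of j i] linear[of i j] by argo
    show "subspace (K i) \<and> K i \<subseteq> W" "subspace (L i) \<and> L i \<subseteq> W" for i using K L by simp_all
  qed blast
  have image: "e \<in> f (a, b) (top, top) ` V (a, b) \<longleftrightarrow> e \<in> K a \<and> e \<in> L b" for a b
  proof
    assume "e \<in> f (a, b) (top, top) ` V (a, b)"
    then show "e \<in> K a \<and> e \<in> L b"
      using image_f_mono[of "(a, b)" "(a, top)" "(top, top)"]
        image_f_mono[of "(a, b)" "(top, b)" "(top, top)"] by (auto simp: K_def L_def)
  next
    assume "e \<in> K a \<and> e \<in> L b"
    then obtain q p where pq: "e = f (a, top) (top, top) q" "q \<in> V (a, top)"
      "e = f (top, b) (top, top) p" "p \<in> V (top, b)"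
      unfolding K_def L_def by (elim conjE imageE)
    then obtain v where v: "v \<in> V (a, b)" "f (a, b) (top, b) v = p"
      using rectangle_exact[of a top b top p q] by auto
    then have "f (a, b) (top, top) v = e" using f_comp[of "(a, b)" "(top, b)" "(top, top)" v] pq by simp
    then show "e \<in> f (a, b) (top, top) ` V (a, b)" using v(1) by blast
  qed
  \<comment> \<open>By injectivity the chosen preimage is the only one, which makes \<open>g\<close>
    compatible with the structure maps.\<close>
  define g where "g x = (if e \<in> f x (top, top) ` V x then SOME v. v \<in> V x \<and> f x (top, top) v = e else 0)" for x
  have g: "g x \<in> V x \<and> f x (top, top) (g x) = e" if "e \<in> f x (top, top) ` V x" for x
  proof -
    have "\<exists>v. v \<in> V x \<and> f x (top, top) v = e" using that by auto
    from someI_ex[OF this] show ?thesis using that by (simp add: g_def)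
  qed
  have g0: "g x = 0 \<longleftrightarrow> e \<notin> f x (top, top) ` V x" for x
  proof
    show "e \<notin> f x (top, top) ` V x" if "g x = 0"
      using g[of x] that e(2) f_0[OF le[of x]] by auto
  qed (simp add: g_def)
  have gV: "g x \<in> V x" for x
    using g[of x] g0[of x] subspace_0[OF subspace_V] by metis
  have supp: "{x. g x \<noteq> 0} = {a. e \<in> K a} \<times> {b. e \<in> L b}"
    using image g0 by auto
  have sec: "f x y (g x) = g y" if "x \<le> y" "g x \<noteq> 0" for x y
  proof -
    have x: "e \<in> f x (top, top) ` V x" using that g0 by blast
    then have y: "e \<in> f y (top, top) ` V y" using image_f_mono[OF that(1) le] by (rule set_mp[rotated])
    show ?thesis
    proof (rule inj)
      show "f x y (g x) \<in> V y" using f_in[OF that(1)] gV by blast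
      show "f y (top, top) (f x y (g x)) = f y (top, top) (g y)"
        using g[OF x] g[OF y] f_comp[OF that(1) le, of "g x"] by simp
    qed (rule gV)
  qed
  have "splitting_section s V f g"
    unfolding splitting_section_def
  proof (intro conjI allI impI)
    have "e \<in> f (top, top) (top, top) ` V (top, top)" using f_id[of e "(top, top)"] e(1) unfolding W_def by force
    then show "\<exists>x. g x \<noteq> 0" using g0 by blast
    have K0: "K 0 = {0}" "L 0 = {0}"
      using zero f_0[OF le] by (auto simp: K_def L_def)
    \<comment> \<open>A vector from outside the support lands in some \<open>K a\<close> or
      \<open>L b\<close> that misses \<open>e\<close>. As nonempty unions of chains,
      \<open>KK\<close> and \<open>LL\<close> are subspaces, so the whole span lands in their sum,
      which misses \<open>e\<close> by adaptedness.\<close>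
    define KK where "KK = (\<Union>a\<in>{a. e \<notin> K a}. K a)"
    define LL where "LL = (\<Union>b\<in>{b. e \<notin> L b}. L b)"
    have "0 \<in> {a. e \<notin> K a}" "0 \<in> {b. e \<notin> L b}" using K0 e(2) by auto
    then have ne: "{a. e \<notin> K a} \<noteq> {}" "{b. e \<notin> L b} \<noteq> {}" "0 \<in> KK" "0 \<in> LL"
      using K0 unfolding KK_def LL_def by blast+
    have "subspace KK" "subspace LL"
    proof -
      have "KK = (\<Union>x\<in>(\<lambda>a. (a, top)) ` {a. e \<notin> K a}. f x (top, top) ` V x)"
        by (simp add: KK_def K_def)
      also have "subspace \<dots>"
        using ne(1) directed_mono_image[of "\<lambda>a. (a, top)" _ "{a. e \<notin> K a}"]
        by (intro subspace_Union_image_f) (simp_all add: le mono_def del: bex_simps ball_simps image_iff)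
      finally show "subspace KK" .
      have "LL = (\<Union>x\<in>(\<lambda>b. (top, b)) ` {b. e \<notin> L b}. f x (top, top) ` V x)"
        by (simp add: LL_def L_def)
      also have "subspace \<dots>"
        using ne(2) directed_mono_image[of "\<lambda>b. (top, b)" _ "{b. e \<notin> L b}"]
        by (intro subspace_Union_image_f) (simp_all add: le mono_def del: bex_simps ball_simps image_iff)
      finally show "subspace LL" .
    qed
    then have sub: "subspace {u + v | u v. u \<in> KK \<and> v \<in> LL}" by (rule subspace_sums)
    fix z assume z: "g z \<noteq> 0"
    show "g z \<notin> span {f w z v | w v. w \<le> z \<and> g w = 0 \<and> v \<in> V w}"
    proof
      assume "g z \<in> span {f w z v | w v. w \<le> z \<and> g w = 0 \<and> v \<in> V w}"
      also have "\<dots> \<subseteq> {v \<in> V z. f z (top, top) v \<in> {u + v | u v. u \<in> KK \<and> v \<in> LL}}"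
      proof (rule span_minimal[OF _ subspace_vimage_f[OF le sub]], rule subsetI)
        fix y assume "y \<in> {f w z v | w v. w \<le> z \<and> g w = 0 \<and> v \<in> V w}"
        then obtain a b v where w: "(a, b) \<le> z" "g (a, b) = 0" "v \<in> V (a, b)" and y: "y = f (a, b) z v"
          by auto
        then have "e \<notin> K a \<or> e \<notin> L b" using image g0 by blast
        moreover have "f (a, b) (top, top) v \<in> K a" "f (a, b) (top, top) v \<in> L b"
          using image_f_mono[of "(a, b)" "(a, top)" "(top, top)"] w(3)
            image_f_mono[of "(a, b)" "(top, b)" "(top, top)"] by (auto simp: K_def L_def)
        ultimately have "f (a, b) (top, top) v \<in> KK \<or> f (a, b) (top, top) v \<in> LL"
          unfolding KK_def LL_def by blast
        then have "f (a, b) (top, top) v \<in> {u + v | u v. u \<in> KK \<and> v \<in> LL}"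
          using ne(3,4) by force
        then show "y \<in> {v \<in> V z. f z (top, top) v \<in> {u + v | u v. u \<in> KK \<and> v \<in> LL}}"
          unfolding y using f_comp[OF w(1) le w(3)] f_in[OF w(1,3)] by simp
      qed
      finally have "f z (top, top) (g z) \<in> {u + v | u v. u \<in> KK \<and> v \<in> LL}" by blast
      moreover have "f z (top, top) (g z) = e" using g g0 z by blast
      ultimately obtain a b u v where
        "e \<notin> K a" "e \<notin> L b" "u \<in> K a" "v \<in> L b" "e = u + v"
        unfolding KK_def LL_def by auto
      then show False using e(3) by blast
    qed
  qed (use gV sec in auto)
  moreover have "up_closed {a. e \<in> K a}" "up_closed {b. e \<in> L b}"
    unfolding up_closed_def using K_mono L_mono by blast+
  ultimately show thesis
    using block_rectangle_support supp that unfolding block_def birth_block_def by blast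
qed

text \<open>As \<open>V (0, 0)\<close> is zero, exactness makes the maps going up from the axis
  injective, so a section on the axis survives at every height. A vector entering from outside is
  brought down to the axis by exactness, where the one-parameter lemma excludes it.\<close>

lemma vertical_section:
  assumes zero: "V (0, 0) = {0}" and t: "V (t, 0) \<noteq> {0}"
  obtains e J where "splitting_section s V f e" "poset_interval J" "{x. e x \<noteq> 0} = J \<times> UNIV"
proof -
  interpret A: vec_functor s "\<lambda>a. V (a, 0)" "\<lambda>a b. f (a, 0) (b, 0)"
    by unfold_locales (auto simp: subspace_V linear_f f_id f_comp)
  have "pointwise_finite_dim s (\<lambda>a. V (a, 0))" using pfd by (simp add: pointwise_finite_dim_def)
  then obtain c where c: "c t \<noteq> 0" "\<And>x. c x \<in> V (x, 0)"
    "\<And>x y. x \<le> y \<Longrightarrow> c x \<noteq> 0 \<Longrightarrow> f (x, 0) (y, 0) (c x) = c y"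
    "\<And>x y. x \<le> y \<Longrightarrow> c x = 0 \<Longrightarrow> c y \<noteq> 0 \<Longrightarrow> c y \<notin> f (x, 0) (y, 0) ` V (x, 0)"
    using exists_section_one_parameter[OF A.vec_functor_axioms _ t] by blast
  have c0: "c 0 = 0" using c(2)[of 0] zero by simp
  define g where "g x = f (fst x, 0) x (c (fst x))" for x
  have le: "(fst x, 0) \<le> x" for x :: "ennreal \<times> ennreal" by (simp add: less_eq_prod_def)
  have gV: "g x \<in> V x" for x using f_in[OF le c(2)] by (simp add: g_def)
  have inj: "v = 0" if v: "v \<in> V (a, 0)" "f (a, 0) (a, b) v = 0" for a b v
  proof -
    have "\<exists>u\<in>V (0, 0). f (0, 0) (a, 0) u = v \<and> f (0, 0) (0, b) u = 0"
      using v f_0[of "(0, b)" "(a, b)"] subspace_0[OF subspace_V]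
      by (intro rectangle_exact) auto
    then show ?thesis using zero f_0[of "(0, 0)" "(a, 0)"] by auto
  qed
  have g0: "g x = 0 \<longleftrightarrow> c (fst x) = 0" for x
    using inj[OF c(2), of "fst x" "snd x"] f_0[OF le[of x]] by (auto simp: g_def)
  have sec: "f x y (g x) = g y" if "x \<le> y" "g x \<noteq> 0" for x y
  proof -
    have xy: "(fst x, 0::ennreal) \<le> (fst y, 0)" "fst x \<le> fst y"
      using that(1) by (auto simp: less_eq_prod_def)
    have "f x y (g x) = f (fst x, 0) y (c (fst x))"
      using f_comp[OF le that(1) c(2)] by (simp add: g_def)
    also have "\<dots> = f (fst y, 0) y (f (fst x, 0) (fst y, 0) (c (fst x)))"
      using f_comp[OF xy(1) le c(2)] by simp
    finally show ?thesis using c(3)[OF xy(2)] that(2) g0 by (simp add: g_def)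
  qed
  have "splitting_section s V f g"
    unfolding splitting_section_def
  proof (intro conjI allI impI)
    show "\<exists>x. g x \<noteq> 0" using c(1) g0[of "(t, 0)"] by auto
    fix z assume z: "g z \<noteq> 0"
    obtain u b where ub: "z = (u, b)" by (cases z)
    \<comment> \<open>Anything entering from \<open>(i, j)\<close> passes through
      \<open>(i, b)\<close>, so only points at the height of \<open>z\<close> in columns outside the
      support matter. They form a chain, and \<open>c0\<close> puts the column \<open>0\<close>
      among them.\<close>
    define S where "S = {s. s \<le> u \<and> c s = 0}"
    show "g z \<notin> span {f w z v | w v. w \<le> z \<and> g w = 0 \<and> v \<in> V w}"
    proof
      assume "g z \<in> span {f w z v | w v. w \<le> z \<and> g w = 0 \<and> v \<in> V w}"
      also have "\<dots> \<subseteq> (\<Union>x\<in>(\<lambda>s. (s, b)) ` S. f x z ` V x)"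
      proof (rule span_minimal)
        show "subspace (\<Union>x\<in>(\<lambda>s. (s, b)) ` S. f x z ` V x)"
        proof (rule subspace_Union_image_f)
          have "0 \<in> S" using c0 by (simp add: S_def)
          then show "(\<lambda>s. (s, b)) ` S \<noteq> {}" by blast
          show "x \<le> z" if "x \<in> (\<lambda>s. (s, b)) ` S" for x using that by (auto simp: S_def ub)
          show "\<exists>w\<in>(\<lambda>s. (s, b)) ` S. x \<le> w \<and> y \<le> w"
            if "x \<in> (\<lambda>s. (s, b)) ` S" "y \<in> (\<lambda>s. (s, b)) ` S" for x y
            using that by (intro directed_mono_image) (auto intro: monoI)
        qed
        show "{f w z v | w v. w \<le> z \<and> g w = 0 \<and> v \<in> V w} \<subseteq> (\<Union>x\<in>(\<lambda>s. (s, b)) ` S. f x z ` V x)"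
        proof clarify
          fix i j v assume w: "(i, j) \<le> z" "g (i, j) = 0" "v \<in> V (i, j)"
          then have "i \<in> S" using g0 by (auto simp: S_def ub)
          moreover have "f (i, j) z v \<in> f (i, b) z ` V (i, b)"
            using image_f_mono[of "(i, j)" "(i, b)" z] w by (auto simp: ub)
          ultimately show "f (i, j) z v \<in> (\<Union>x\<in>(\<lambda>s. (s, b)) ` S. f x z ` V x)" by blast
        qed
      qed
      finally obtain i q where i: "i \<le> u" "c i = 0" "q \<in> V (i, b)" "f (u, 0) (u, b) (c u) = f (i, b) (u, b) q"
        unfolding S_def g_def ub by auto
      \<comment> \<open>In the rectangle with corners \<open>(i, 0)\<close> and
        \<open>(u, b)\<close> the vectors \<open>c u\<close> and \<open>q\<close> agree at
        \<open>(u, b)\<close>, so \<open>c u\<close> comes from \<open>V (i, 0)\<close>.\<close>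
      then obtain v where "v \<in> V (i, 0)" "f (i, 0) (u, 0) v = c u"
        using rectangle_exact[of i u 0 b "c u" q] c(2) by auto
      then have "c u \<in> f (i, 0) (u, 0) ` V (i, 0)" by (metis imageI)
      moreover have "c u \<noteq> 0" using z g0 by (simp add: ub)
      ultimately show False using c(4) i(1,2) by blast
    qed
  qed (use gV sec in auto)
  moreover have "poset_interval {x. c x \<noteq> 0}"
  proof (rule poset_interval_linorder)
    fix x y z assume *: "x \<in> {x. c x \<noteq> 0}" "y \<in> {x. c x \<noteq> 0}" "x \<le> z" "z \<le> y"
    then show "z \<in> {x. c x \<noteq> 0}"
      using support_convex[OF \<open>splitting_section s V f g\<close>, of "(x, 0)" "(z, 0)" "(y, 0)"] g0 by simp
  qed
  moreover have "{x. g x \<noteq> 0} = {x. c x \<noteq> 0} \<times> UNIV" using g0 by auto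
  ultimately show thesis by (rule that)
qed

text \<open>Exchanging the coordinates exchanges the roles of \<open>p\<close> and \<open>q\<close>
  in exactness; horizontal blocks are thereby reduced to vertical ones.\<close>

lemma swap_functor:
  "rectangle_exact_functor s (\<lambda>x. V (prod.swap x)) (\<lambda>x y. f (prod.swap x) (prod.swap y))"
proof
  have le: "prod.swap x \<le> prod.swap y" if "x \<le> y" for x y :: "ennreal \<times> ennreal"
    using that by (auto simp: less_eq_prod_def)
  show "subspace (V (prod.swap x))" for x using subspace_V .
  show "linear_between s s (V (prod.swap x)) (V (prod.swap y)) (f (prod.swap x) (prod.swap y))"
    if "x \<le> y" for x y using linear_f[OF le[OF that]] .
  show "f (prod.swap x) (prod.swap x) v = v" if "v \<in> V (prod.swap x)" for x v using f_id[OF that] .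
  show "f (prod.swap y) (prod.swap z) (f (prod.swap x) (prod.swap y) v) = f (prod.swap x) (prod.swap z) v"
    if "x \<le> y" "y \<le> z" "v \<in> V (prod.swap x)" for x y z v using f_comp[OF le[OF that(1)] le[OF that(2)] that(3)] .
  show "pointwise_finite_dim s (\<lambda>x. V (prod.swap x))" using pfd by (simp add: pointwise_finite_dim_def)
  fix a c b d p q
  assume "a \<le> c" "b \<le> d" "p \<in> V (prod.swap (c, b))" "q \<in> V (prod.swap (a, d))"
    "f (prod.swap (c, b)) (prod.swap (c, d)) p = f (prod.swap (a, d)) (prod.swap (c, d)) q"
  then show "\<exists>v\<in>V (prod.swap (a, b)). f (prod.swap (a, b)) (prod.swap (c, b)) v = p \<and>
      f (prod.swap (a, b)) (prod.swap (a, d)) v = q"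
    using rectangle_exact[of b d a c q p] by auto
qed

lemma horizontal_section:
  assumes zero: "V (0, 0) = {0}" and t: "V (0, t) \<noteq> {0}"
  obtains e J where "splitting_section s V f e" "poset_interval J" "{x. e x \<noteq> 0} = UNIV \<times> J"
proof -
  interpret S: rectangle_exact_functor s "\<lambda>x. V (prod.swap x)" "\<lambda>x y. f (prod.swap x) (prod.swap y)"
    by (rule swap_functor)
  obtain e J where e: "splitting_section s (\<lambda>x. V (prod.swap x)) (\<lambda>x y. f (prod.swap x) (prod.swap y)) e"
    "poset_interval J" "{x. e x \<noteq> 0} = J \<times> UNIV"
    using S.vertical_section[of t] zero t by auto
  define g where "g x = e (prod.swap x)" for x
  have le: "prod.swap x \<le> prod.swap y \<longleftrightarrow> x \<le> y" for x y :: "ennreal \<times> ennreal"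
    by (auto simp: less_eq_prod_def)
  have E: "e x \<in> V (prod.swap x)" "\<exists>x. e x \<noteq> 0"
    "x \<le> y \<Longrightarrow> e x \<noteq> 0 \<Longrightarrow> f (prod.swap x) (prod.swap y) (e x) = e y"
    "e z \<noteq> 0 \<Longrightarrow> e z \<notin> span {f (prod.swap w) (prod.swap z) v | w v. w \<le> z \<and> e w = 0 \<and> v \<in> V (prod.swap w)}"
    for x y z
    using splitting_sectionD[OF e(1)] by blast+
  have "splitting_section s V f g"
    unfolding splitting_section_def
  proof (intro conjI allI impI)
    show "g x \<in> V x" for x
      using E(1)[of "prod.swap x"] by (simp add: g_def)
    obtain x where "e x \<noteq> 0" using E(2) by blast
    then have "g (prod.swap x) \<noteq> 0" by (simp add: g_def)
    then show "\<exists>x. g x \<noteq> 0" by blast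
    show "f x y (g x) = g y" if "x \<le> y" "g x \<noteq> 0" for x y
      using E(3)[of "prod.swap x" "prod.swap y"] that le by (simp add: g_def)
    fix z assume z: "g z \<noteq> 0"
    have "{f w z v | w v. w \<le> z \<and> g w = 0 \<and> v \<in> V w} \<subseteq>
        {f (prod.swap w) (prod.swap (prod.swap z)) v | w v. w \<le> prod.swap z \<and> e w = 0 \<and> v \<in> V (prod.swap w)}"
    proof clarify
      fix a b v assume "(a, b) \<le> z" "g (a, b) = 0" "v \<in> V (a, b)"
      then show "\<exists>w v'. f (a, b) z v = f (prod.swap w) (prod.swap (prod.swap z)) v' \<and>
          w \<le> prod.swap z \<and> e w = 0 \<and> v' \<in> V (prod.swap w)"
        using le[of "(a, b)" z] by (intro exI[of _ "(b, a)"] exI[of _ v]) (simp add: g_def)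
    qed
    from span_mono[OF this] show "g z \<notin> span {f w z v | w v. w \<le> z \<and> g w = 0 \<and> v \<in> V w}"
      using E(4)[of "prod.swap z"] z unfolding g_def by blast
  qed
  moreover have "{x. g x \<noteq> 0} = UNIV \<times> J"
    using e(3) by (auto simp: g_def set_eq_iff)
  ultimately show thesis using e(2) that by blast
qed

lemma exists_splitting_section:
  assumes "V x \<noteq> {0}"
  obtains e where "splitting_section s V f e" "block {x. e x \<noteq> 0}"
proof -
  consider (death) "V (0, 0) \<noteq> {0}"
    | (vertical) t where "V (0, 0) = {0}" "V (t, 0) \<noteq> {0}"
    | (horizontal) t where "V (0, 0) = {0}" "V (0, t) \<noteq> {0}"
    | (birth) "\<forall>a. V (a, 0) = {0}" "\<forall>b. V (0, b) = {0}" by metis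
  then show thesis
  proof cases
    case death
    then show ?thesis by (rule death_section) (rule that)
  next
    case vertical
    then obtain e J where e: "splitting_section s V f e" "poset_interval J" "{x. e x \<noteq> 0} = J \<times> UNIV"
      by (rule vertical_section)
    have "block {x. e x \<noteq> 0}"
      using block_rectangle_support[OF e(1,3)] e(2,3) unfolding block_def vertical_block_def by blast
    with e(1) show ?thesis by (rule that)
  next
    case horizontal
    then obtain e J where e: "splitting_section s V f e" "poset_interval J" "{x. e x \<noteq> 0} = UNIV \<times> J"
      by (rule horizontal_section)
    have "block {x. e x \<noteq> 0}"
      using block_rectangle_support[OF e(1,3)] e(2,3) unfolding block_def horizontal_block_def by blast
    with e(1) show ?thesis by (rule that)
  next
    case birth
    show ?thesis by (rule birth_section[OF _ _ assms]) (use birth in simp, use birth in simp, rule that)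
  qed
qed

end

section \<open>The decomposition\<close>

text \<open>The fourth clause says at once that the nonzero vectors among \<open>e x\<close>, \<open>e \<in> E\<close>, are distinct and
  linearly independent, and that their span meets \<open>N x\<close> trivially.\<close>

definition partial_decomposition ::
  "('k::field \<Rightarrow> 'v::ab_group_add \<Rightarrow> 'v) \<Rightarrow> (ennreal \<times> ennreal \<Rightarrow> 'v set) \<Rightarrow>
   (ennreal \<times> ennreal \<Rightarrow> ennreal \<times> ennreal \<Rightarrow> 'v \<Rightarrow> 'v) \<Rightarrow>
   (ennreal \<times> ennreal \<Rightarrow> 'v) set \<Rightarrow> (ennreal \<times> ennreal \<Rightarrow> 'v set) \<Rightarrow> bool" where
  "partial_decomposition s V f E N \<longleftrightarrow>
     (\<forall>e\<in>E. block {x. e x \<noteq> 0} \<and> (\<exists>x. e x \<noteq> 0) \<and> (\<forall>x. e x \<in> V x) \<and>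
        (\<forall>x y. x \<le> y \<longrightarrow> e x \<noteq> 0 \<longrightarrow> f x y (e x) = e y)) \<and>
     (\<forall>x. module.subspace s (N x) \<and> N x \<subseteq> V x) \<and>
     (\<forall>x y. x \<le> y \<longrightarrow> f x y ` N x \<subseteq> N y) \<and>
     (\<forall>x F c. finite F \<longrightarrow> F \<subseteq> E \<longrightarrow> (\<Sum>e\<in>F. s (c e) (e x)) \<in> N x \<longrightarrow>
        (\<forall>e\<in>F. e x \<noteq> 0 \<longrightarrow> c e = 0)) \<and>
     (\<forall>x. \<forall>v\<in>V x. \<exists>F c. finite F \<and> F \<subseteq> E \<and> v - (\<Sum>e\<in>F. s (c e) (e x)) \<in> N x)"

lemma partial_decompositionD:
  assumes "partial_decomposition s V f E N"
  shows "e \<in> E \<Longrightarrow> block {x. e x \<noteq> 0}" "e \<in> E \<Longrightarrow> \<exists>x. e x \<noteq> 0" "e \<in> E \<Longrightarrow> e x \<in> V x"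
    "e \<in> E \<Longrightarrow> x \<le> y \<Longrightarrow> e x \<noteq> 0 \<Longrightarrow> f x y (e x) = e y"
    "module.subspace s (N x)" "N x \<subseteq> V x" "x \<le> y \<Longrightarrow> f x y ` N x \<subseteq> N y"
    "finite F \<Longrightarrow> F \<subseteq> E \<Longrightarrow> (\<Sum>e\<in>F. s (c e) (e x)) \<in> N x \<Longrightarrow> e \<in> F \<Longrightarrow> e x \<noteq> 0 \<Longrightarrow> c e = 0"
    "v \<in> V x \<Longrightarrow> \<exists>F c. finite F \<and> F \<subseteq> E \<and> v - (\<Sum>e\<in>F. s (c e) (e x)) \<in> N x"
proof -
  have *: "finite F \<longrightarrow> F \<subseteq> E \<longrightarrow> (\<Sum>e\<in>F. s (c e) (e x)) \<in> N x \<longrightarrow> (\<forall>e\<in>F. e x \<noteq> 0 \<longrightarrow> c e = 0)"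
    using assms unfolding partial_decomposition_def by (elim conjE allE)
  show "finite F \<Longrightarrow> F \<subseteq> E \<Longrightarrow> (\<Sum>e\<in>F. s (c e) (e x)) \<in> N x \<Longrightarrow> e \<in> F \<Longrightarrow> e x \<noteq> 0 \<Longrightarrow> c e = 0"
    using * by blast
qed (use assms in \<open>simp_all add: partial_decomposition_def del: split_paired_All split_paired_Ex\<close>)

section \<open>Remainders and a maximal decomposition\<close>

context rectangle_exact_functor
begin

text \<open>The remainder is a direct summand: a lift in \<open>V\<close> of data in
  \<open>N\<close> may be replaced by its component in \<open>N\<close>, since the sections in
  \<open>E\<close> contribute nothing where the image already lies in \<open>N\<close>.\<close>

lemma remainder_functor:
  assumes "partial_decomposition s V f E N"
  shows "rectangle_exact_functor s N f"
proof
  note D = partial_decompositionD[OF assms]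
  show "subspace (N x)" for x by (rule D)
  show "linear_between s s (N x) (N y) (f x y)" if "x \<le> y" for x y
    using linear_f[OF that] D(6)[of x] D(7)[OF that] unfolding linear_between_def by blast
  show "f x x v = v" if "v \<in> N x" for x v using that D(6) f_id by blast
  show "f y z (f x y v) = f x z v" if "x \<le> y" "y \<le> z" "v \<in> N x" for x y z v
    using that D(6) f_comp by blast
  show "pointwise_finite_dim s N"
    unfolding pointwise_finite_dim_def
  proof
    fix x
    obtain B where B: "finite B" "span B = V x" using finite_dim_V[OF pfd] .
    obtain A where A: "A \<subseteq> N x" "independent A" "N x \<subseteq> span A"
      using maximal_independent_subset[of "N x"] by blast
    have "finite A" using independent_span_bound[OF B(1) A(2)] A(1) D(6)[of x] B(2) by blast
    moreover have "span A = N x" using A D(5)[of x] by (simp add: span_minimal subset_antisym)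
    ultimately show "\<exists>B. finite B \<and> span B = N x" by blast
  qed
  fix a b c d :: ennreal and p q
  assume le: "a \<le> c" "b \<le> d" and pq: "p \<in> N (c, b)" "q \<in> N (a, d)" "f (c, b) (c, d) p = f (a, d) (c, d) q"
  then obtain v where v: "v \<in> V (a, b)" "f (a, b) (c, b) v = p" "f (a, b) (a, d) v = q"
    using rectangle_exact[OF le] D(6) by blast
  obtain F k where F: "finite F" "F \<subseteq> E" and n: "v - (\<Sum>e\<in>F. s (k e) (e (a, b))) \<in> N (a, b)"
    using D(9)[OF v(1)] by blast
  define n where "n = v - (\<Sum>e\<in>F. s (k e) (e (a, b)))"
  have N: "n \<in> N (a, b)" "n \<in> V (a, b)" using n D(6) by (auto simp: n_def)
  have key: "f (a, b) y n = f (a, b) y v" if y: "(a, b) \<le> y" "f (a, b) y v \<in> N y" for y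
  proof -
    \<comment> \<open>\<open>e y\<close> may be nonzero although \<open>e (a, b) = 0\<close>, so the
      coefficients of such \<open>e\<close> are set to zero before passing from
      \<open>(a, b)\<close> to \<open>y\<close>.\<close>
    define k' where "k' e = (if e (a, b) = 0 then 0 else k e)" for e
    have fe: "f (a, b) y (s (k e) (e (a, b))) = s (k' e) (e y)" if "e \<in> F" for e
      using D(4)[of e "(a, b)" y] D(3)[of e] F(2) that y(1) f_scale[OF y(1)] f_0[OF y(1)]
      by (auto simp: k'_def)
    have eV: "s (k e) (e (a, b)) \<in> V (a, b)" if "e \<in> F" for e
      using D(3)[of e] F(2) that subspace_scale[OF subspace_V] by blast
    have "f (a, b) y (\<Sum>e\<in>F. s (k e) (e (a, b))) = (\<Sum>e\<in>F. s (k' e) (e y))"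
      using f_sum[OF y(1), of F "\<lambda>e. s (k e) (e (a, b))"] eV fe by simp
    then have diff: "f (a, b) y n = f (a, b) y v - (\<Sum>e\<in>F. s (k' e) (e y))"
      unfolding n_def using f_diff[OF y(1) v(1) subspace_sum[OF subspace_V eV], of F "\<lambda>e. e"] by simp
    moreover have "f (a, b) y n \<in> N y" using D(7)[OF y(1)] N(1) by blast
    \<comment> \<open>The sum is a difference of two vectors of \<open>N y\<close>, so independence
      modulo \<open>N y\<close> kills its terms.\<close>
    ultimately have "(\<Sum>e\<in>F. s (k' e) (e y)) \<in> N y"
      using subspace_diff[OF D(5) y(2), of "f (a, b) y n"] by simp
    then have "s (k' e) (e y) = 0" if "e \<in> F" for e
      using D(8)[OF F, of k' y e] that by (cases "e y = 0") auto
    then have "(\<Sum>e\<in>F. s (k' e) (e y)) = 0" by (rule sum.neutral[OF ballI])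
    then show ?thesis using diff by simp
  qed
  show "\<exists>v\<in>N (a, b). f (a, b) (c, b) v = p \<and> f (a, b) (a, d) v = q"
    using N(1) key[of "(c, b)"] key[of "(a, d)"] v pq le by auto
qed

text \<open>The new section splits the remainder functor. It is not in \<open>E\<close>, because its
  values lie in \<open>N\<close>, which the nonzero values of members of \<open>E\<close> avoid;
  strict growth of \<open>E\<close> is what contradicts maximality.\<close>

lemma extend_partial_decomposition:
  assumes P: "partial_decomposition s V f E N" and "N x0 \<noteq> {0}"
  obtains e N' where "partial_decomposition s V f (insert e E) N'" "\<And>x. N' x \<subseteq> N x" "e \<notin> E"
proof -
  note D = partial_decompositionD[OF P]
  interpret N: rectangle_exact_functor s N f using remainder_functor[OF P] .
  obtain e where e: "splitting_section s N f e" "block {x. e x \<noteq> 0}"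
    using N.exists_splitting_section[OF assms(2)] .
  note S = splitting_sectionD[OF e(1)]
  have dir: "\<exists>z. e z \<noteq> 0 \<and> x \<le> z \<and> y \<le> z" if "e x \<noteq> 0" "e y \<noteq> 0" for x y
    using block_directed[OF e(2), of x y] that by blast
  obtain N' where N': "\<And>x. subspace (N' x)" "\<And>x. N' x \<subseteq> N x"
    "\<And>x y. x \<le> y \<Longrightarrow> f x y ` N' x \<subseteq> N' y"
    "\<And>x. e x \<noteq> 0 \<Longrightarrow> e x \<notin> N' x" "\<And>x v. v \<in> N x \<Longrightarrow> \<exists>c. v - s c (e x) \<in> N' x"
    using N.section_splits[of e, OF S(1) S(3) dir S(4)] by blast
  have eE: "e \<notin> E"
  proof
    assume "e \<in> E"
    obtain x where "e x \<noteq> 0" using S(2) by blast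
    then show False
      using D(8)[of "{e}" "\<lambda>_. 1" x e] \<open>e \<in> E\<close> S(1)[of x] by simp
  qed
  have "partial_decomposition s V f (insert e E) N'"
    unfolding partial_decomposition_def
  proof (intro conjI ballI allI impI)
    fix x F c g assume F: "finite F" "F \<subseteq> insert e E" "(\<Sum>e\<in>F. s (c e) (e x)) \<in> N' x"
      and g: "g \<in> F" "g x \<noteq> 0"
    define c' where "c' = c(e := if e \<in> F then c e else 0)"
    have split: "(\<Sum>e\<in>F. s (c e) (e x)) = s (c' e) (e x) + (\<Sum>e\<in>F - {e}. s (c e) (e x))"
      using F(1) by (auto simp: c'_def sum.remove)
    have ce: "s (c' e) (e x) \<in> N x" using S(1) subspace_scale[OF D(5)] by blast
    \<comment> \<open>Removing the multiple of the new section, which lies in \<open>N x\<close>,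
      leaves a combination of members of \<open>E\<close> in \<open>N x\<close>. Its terms vanish,
      and only that multiple remains.\<close>
    have "(\<Sum>e\<in>F - {e}. s (c e) (e x)) \<in> N x"
      using subspace_diff[OF D(5) _ ce, of "\<Sum>e\<in>F. s (c e) (e x)"] F(3) N'(2)[of x] split by auto
    then have zero: "c h = 0" if "h \<in> F - {e}" "h x \<noteq> 0" for h
      using D(8)[of "F - {e}" c x h] F(1,2) that by blast
    show "c g = 0"
    proof (cases "g = e")
      case True
      have "(\<Sum>e\<in>F - {e}. s (c e) (e x)) = 0"
        using zero by (intro sum.neutral) (metis scale_zero_left scale_zero_right)
      then have "s (c e) (e x) \<in> N' x" using F(3) split g True by (simp add: c'_def)
      show ?thesis
      proof (rule ccontr)
        assume "c g \<noteq> 0"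
        then have "e x \<in> N' x"
          using subspace_scale[OF N'(1) \<open>s (c e) (e x) \<in> N' x\<close>, of "inverse (c e)"] True by simp
        then show False using N'(4) g True by blast
      qed
    next
      case False
      then show ?thesis using zero g by blast
    qed
  next
    fix x v assume v: "v \<in> V x"
    obtain F c where F: "finite F" "F \<subseteq> E" "v - (\<Sum>e\<in>F. s (c e) (e x)) \<in> N x"
      using D(9)[OF v] by blast
    obtain k where k: "v - (\<Sum>e\<in>F. s (c e) (e x)) - s k (e x) \<in> N' x" using N'(5)[OF F(3)] by blast
    have "e \<notin> F" using eE F(2) by blast
    then have "(\<Sum>g\<in>insert e F. s ((c(e := k)) g) (g x)) = s k (e x) + (\<Sum>e\<in>F. s (c e) (e x))"
      using F(1) by (simp add: sum.cong[of F F "\<lambda>g. s (if g = e then k else c g) (g x)" "\<lambda>g. s (c g) (g x)"] cong: if_cong)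
        (auto intro!: sum.cong)
    then have "v - (\<Sum>g\<in>insert e F. s ((c(e := k)) g) (g x)) \<in> N' x"
      using k by (simp add: algebra_simps)
    then show "\<exists>F c. finite F \<and> F \<subseteq> insert e E \<and> v - (\<Sum>e\<in>F. s (c e) (e x)) \<in> N' x"
      using F(1,2) by (intro exI[of _ "insert e F"] exI[of _ "c(e := k)"]) auto
  next
    show "N' x \<subseteq> V x" for x using N'(2) D(6) by blast
    show "subspace (N' x)" for x by (rule N')
    show "f x y ` N' x \<subseteq> N' y" if "x \<le> y" for x y using N'(3)[OF that] .
    show "g x \<in> V x" if "g \<in> insert e E" for g x
      using that D(3) S(1) D(6) by blast
    show "block {x. g x \<noteq> 0}" if "g \<in> insert e E" for g
      using that e(2) D(1) by blast
    show "\<exists>x. g x \<noteq> 0" if "g \<in> insert e E" for g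
      using that S(2) D(2) by blast
    show "f x y (g x) = g y" if "g \<in> insert e E" "x \<le> y" "g x \<noteq> 0" for g x y
      using that S(3) D(4) by blast
  qed
  then show thesis using N'(2) eE by (rule that)
qed

lemma exists_decomposition:
  obtains E where "partial_decomposition s V f E (\<lambda>_. {0})"
proof -
  define A where "A = {(E, N). partial_decomposition s V f E N}"
  define P where "P c d \<longleftrightarrow> fst c \<subseteq> fst d \<and> snd d \<le> snd c"
    for c d :: "(ennreal \<times> ennreal \<Rightarrow> 'v) set \<times> (ennreal \<times> ennreal \<Rightarrow> 'v set)"
  have P_iff: "P c d \<longleftrightarrow> fst c \<subseteq> fst d \<and> (\<forall>x. snd d x \<subseteq> snd c x)" for c d
    by (simp add: P_def le_fun_def)
  have "\<exists>m\<in>A. \<forall>a\<in>A. P m a \<longrightarrow> a = m"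
  proof (rule predicate_Zorn)
    show "partial_order_on A (relation_of P A)"
    proof (rule partial_order_on_relation_ofI)
      show "P c c" for c by (simp add: P_def)
      show "P c d" if "P c b" "P b d" for b c d
        using that unfolding P_def by (meson order_trans)
      show "c = d" if "P c d" "P d c" for c d
        using that unfolding P_def by (meson order_antisym prod_eqI)
    qed
    fix C assume C: "C \<in> Chains (relation_of P A)"
    then have rel: "(c, d) \<in> relation_of P A \<or> (d, c) \<in> relation_of P A" if "c \<in> C" "d \<in> C" for c d
      using that unfolding Chains_def by blast
    have chain: "P c d \<or> P d c" if "c \<in> C" "d \<in> C" for c d
      using rel[OF that] unfolding relation_of_def by blast
    have CA: "c \<in> A" if "c \<in> C" for c
      using rel[OF that that] unfolding relation_of_def by blast
    show "\<exists>u\<in>A. \<forall>a\<in>C. P a u"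
    proof (cases "C = {}")
      case True
      have "({}, V) \<in> A"
        using subspace_V f_in by (auto simp: A_def partial_decomposition_def intro: exI[of _ "{}"])
      then show ?thesis using True by blast
    next
      case False
      define E where "E = (\<Union>c\<in>C. fst c)"
      define N where "N x = (\<Inter>c\<in>C. snd c x)" for x
      note D = partial_decompositionD[of s V f "fst c" "snd c" for c]
      have dec: "partial_decomposition s V f (fst c) (snd c)" if "c \<in> C" for c
        using CA[OF that] by (simp add: A_def case_prod_unfold)
      \<comment> \<open>At each \<open>x\<close> the intersection is a single remainder, with the
        member of the chain depending on \<open>x\<close>. Hence generation of \<open>V x\<close>
        passes to the limit even if no member works for all \<open>x\<close>.\<close>
      have attained: "\<exists>c\<in>C. N x = snd c x" for x
      proof -
        obtain B where B: "finite B" "span B = V x" using finite_dim_V[OF pfd] .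
        obtain U where U: "U \<in> (\<lambda>c. snd c x) ` C" "\<And>W. W \<in> (\<lambda>c. snd c x) ` C \<Longrightarrow> U \<subseteq> W"
        proof (rule chain_least_subspace[OF B(1), of "(\<lambda>c. snd c x) ` C"])
          show "(\<lambda>c. snd c x) ` C \<noteq> {}" using False by blast
          show "subspace W \<and> W \<subseteq> span B" if "W \<in> (\<lambda>c. snd c x) ` C" for W
            using that D(5,6)[OF dec] B(2) by blast
          show "W \<subseteq> X \<or> X \<subseteq> W" if WX: "W \<in> (\<lambda>c. snd c x) ` C" "X \<in> (\<lambda>c. snd c x) ` C" for W X
          proof -
            obtain c d where "W = snd c x" "c \<in> C" "X = snd d x" "d \<in> C" using WX by (elim imageE)
            then show ?thesis using chain[of c d] unfolding P_iff by metis
          qed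
        qed blast
        then have "N x = U" unfolding N_def by blast
        then show ?thesis using U(1) by blast
      qed
      have "partial_decomposition s V f E N"
        unfolding partial_decomposition_def
      proof (intro conjI ballI allI impI)
        fix x F c e assume F: "finite F" "F \<subseteq> E" "(\<Sum>e\<in>F. s (c e) (e x)) \<in> N x" "e \<in> F" "e x \<noteq> 0"
        have "\<exists>d\<in>C. F \<subseteq> fst d"
          using F(1,2)
        proof (induction F)
          case empty
          then show ?case using False by blast
        next
          case (insert g F)
          then obtain d where d: "d \<in> C" "F \<subseteq> fst d" by auto
          obtain d' where d': "d' \<in> C" "g \<in> fst d'" using insert.prems by (auto simp: E_def)
          consider "fst d \<subseteq> fst d'" | "fst d' \<subseteq> fst d"
            using chain[OF d(1) d'(1)] unfolding P_iff by argo
          then show ?case using d d' by cases blast+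
        qed
        then obtain d where "d \<in> C" "F \<subseteq> fst d" by blast
        then show "c e = 0" using D(8)[OF dec, of d F c x e] F unfolding N_def by blast
      next
        fix x v assume "v \<in> V x"
        obtain c where c: "c \<in> C" "N x = snd c x" using attained by blast
        then show "\<exists>F k. finite F \<and> F \<subseteq> E \<and> v - (\<Sum>e\<in>F. s (k e) (e x)) \<in> N x"
          using D(9)[OF dec[OF c(1)] \<open>v \<in> V x\<close>] unfolding E_def by fastforce
      next
        show "subspace (N x)" for x using attained[of x] D(5)[OF dec] by metis
        show "N x \<subseteq> V x" for x using attained[of x] D(6)[OF dec] by metis
        show "f x y ` N x \<subseteq> N y" if "x \<le> y" for x y
          using D(7)[OF dec that] unfolding N_def by fast
      qed (use D(1-4)[OF dec] in \<open>auto simp: E_def\<close>)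
      then have "(E, N) \<in> A" by (simp add: A_def)
      moreover have "P c (E, N)" if "c \<in> C" for c
        using that by (auto simp: P_iff E_def N_def split: prod.split)
      ultimately show ?thesis by blast
    qed
  qed
  then obtain E N where EN: "partial_decomposition s V f E N"
    and max: "\<And>E' N'. partial_decomposition s V f E' N' \<Longrightarrow> E \<subseteq> E' \<Longrightarrow> (\<And>x. N' x \<subseteq> N x) \<Longrightarrow> E' = E"
    by (auto simp: A_def P_iff)
  have "N x = {0}" for x
  proof (rule ccontr)
    assume "N x \<noteq> {0}"
    then show False
    proof (rule extend_partial_decomposition[OF EN])
      fix e N' assume "partial_decomposition s V f (insert e E) N'" "\<And>x. N' x \<subseteq> N x" "e \<notin> E"
      then show False using max[of "insert e E" N'] by blast
    qed
  qed
  then have "N = (\<lambda>_. {0})" by blast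
  with EN show thesis using that by simp
qed

end

section \<open>The isomorphism with a direct sum of interval modules\<close>

context rectangle_exact_functor
begin

text \<open>The nonzero values at \<open>x\<close> are distinct and independent in a
  finite-dimensional space. This makes coordinate sums finite and leaves only finitely many sections
  with a given support.\<close>

lemma finite_nonvanishing_sections:
  assumes D: "partial_decomposition s V f E (\<lambda>_. {0})"
  shows "finite {e \<in> E. e x \<noteq> 0}"
proof -
  note D = partial_decompositionD[OF D]
  define Ex where "Ex = {e \<in> E. e x \<noteq> 0}"
  have inj: "inj_on (\<lambda>e. e x) Ex"
  proof (rule inj_onI, rule ccontr)
    fix e g assume *: "e \<in> Ex" "g \<in> Ex" "e x = g x" "e \<noteq> g"
    have "(\<Sum>h\<in>{e, g}. s (if h = e then 1 else - 1) (h x)) = 0" using *(3,4) by simp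
    then have "(if e = e then 1 else - 1 :: 'k) = 0"
      using D(8)[of "{e, g}" "\<lambda>h. if h = e then 1 else - 1" x e] * by (simp add: Ex_def)
    then show False by simp
  qed
  have "independent ((\<lambda>e. e x) ` Ex)"
    unfolding dependent_explicit
  proof (clarify)
    fix S u a assume S: "finite S" "S \<subseteq> (\<lambda>e. e x) ` Ex" "a \<in> S" "u a \<noteq> 0" "(\<Sum>v\<in>S. s (u v) v) = 0"
    define F where "F = {e \<in> Ex. e x \<in> S}"
    have SF: "S = (\<lambda>e. e x) ` F" using S(2) by (auto simp: F_def)
    have injF: "inj_on (\<lambda>e. e x) F" using inj by (rule inj_on_subset) (auto simp: F_def)
    have "finite F" using S(1) injF SF finite_imageD by blast
    moreover have "(\<Sum>e\<in>F. s (u (e x)) (e x)) = 0" using S(5) injF by (simp add: SF sum.reindex)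
    moreover obtain e where "e \<in> F" "a = e x" using S(3) SF by blast
    ultimately show False
      using D(8)[of F "\<lambda>e. u (e x)" x e] S(4) by (auto simp: F_def Ex_def)
  qed
  moreover obtain B where "finite B" "span B = V x" using finite_dim_V[OF pfd] .
  moreover have "(\<lambda>e. e x) ` Ex \<subseteq> V x" using D(3)[of _ x] by (auto simp: Ex_def)
  ultimately have "finite ((\<lambda>e. e x) ` Ex)" using independent_span_bound by metis
  then show ?thesis using inj finite_imageD unfolding Ex_def by blast
qed

lemma iso_of_decomposition:
  assumes PD: "partial_decomposition s V f E (\<lambda>_. {0})"
    and \<iota>: "inj_on \<iota> E" and B: "\<And>e. e \<in> E \<Longrightarrow> B (\<iota> e) = {x. e x \<noteq> 0}"
  shows "vec_functor_iso s V f (dsum_scale (*))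
    (dsum_space (\<iota> ` E) (\<lambda>i. interval_space (B i))) (dsum_map (\<iota> ` E) (\<lambda>i. interval_map (B i)))"
proof -
  note D = partial_decompositionD[OF PD]
  define S where "S x = {e \<in> E. e x \<noteq> 0}" for x
  have fin: "finite (S x)" for x using finite_nonvanishing_sections[OF PD] by (simp add: S_def)
  \<comment> \<open>A section vanishing at \<open>x\<close> puts no constraint on its coefficient;
    fixing it to \<open>0\<close> makes the coordinates unique.\<close>
  define coords where "coords x v c \<longleftrightarrow> (\<forall>e. e \<notin> S x \<longrightarrow> c e = 0) \<and> v = (\<Sum>e\<in>S x. s (c e) (e x))" for x v c
  have unique: "c = d" if "coords x v c" "coords x v d" for x v c d
  proof
    fix e
    have "(\<Sum>e\<in>S x. s (c e - d e) (e x)) = 0"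
      using that by (simp add: coords_def scale_left_diff_distrib sum_subtractf)
    then have "c e - d e = 0" if "e \<in> S x"
      using D(8)[OF fin, of x "\<lambda>e. c e - d e" x e] that by (simp add: S_def)
    then show "c e = d e" using that unfolding coords_def by (cases "e \<in> S x") auto
  qed
  have exists: "\<exists>c. coords x v c" if v: "v \<in> V x" for x v
  proof -
    obtain F c where F: "finite F" "F \<subseteq> E" "v = (\<Sum>e\<in>F. s (c e) (e x))"
      using D(9)[OF v] by auto
    have "(\<Sum>e\<in>S x. s (if e \<in> F \<inter> S x then c e else 0) (e x)) = (\<Sum>e\<in>F \<inter> S x. s (c e) (e x))"
      using fin by (intro sum.mono_neutral_cong_right) auto
    also have "\<dots> = (\<Sum>e\<in>F. s (c e) (e x))"
      using F(1,2) by (intro sum.mono_neutral_left) (auto simp: S_def)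
    finally have "coords x v (\<lambda>e. if e \<in> F \<inter> S x then c e else 0)"
      using F(3) by (simp add: coords_def)
    then show ?thesis by blast
  qed
  define cf where "cf x v = (THE c. coords x v c)" for x v
  have cf_eq: "cf x v = c" if "coords x v c" for x v c
    unfolding cf_def using that unique by blast
  have cf: "coords x v (cf x v)" if v: "v \<in> V x" for x v
    using exists[OF v] cf_eq by metis
  define \<phi> where "\<phi> x v i = (if i \<in> \<iota> ` E then cf x v (inv_into E \<iota> i) else 0)" for x v i
  have \<phi>: "\<phi> x v (\<iota> e) = cf x v e" if "e \<in> E" for x v e
    using that \<iota> by (simp add: \<phi>_def)
  have \<phi>_out: "\<phi> x v i = 0" if "i \<notin> \<iota> ` E" for x v i using that by (simp add: \<phi>_def)
  have family_ext: "a = b" if "\<And>e. e \<in> E \<Longrightarrow> a (\<iota> e) = b (\<iota> e)" "\<And>i. i \<notin> \<iota> ` E \<Longrightarrow> a i = b i"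
    for a b :: "_ \<Rightarrow> 'k"
  proof
    show "a i = b i" for i using that by (cases "i \<in> \<iota> ` E") auto
  qed
  have zero: "cf x v e = 0" if "v \<in> V x" "e \<notin> S x" for x v e
    using cf[OF that(1)] that(2) by (simp add: coords_def)
  have mem: "\<phi> x v \<in> dsum_space (\<iota> ` E) (\<lambda>i. interval_space (B i)) x" if v: "v \<in> V x" for x v
  proof -
    have "{i. \<phi> x v i \<noteq> 0} \<subseteq> \<iota> ` S x"
    proof
      fix i assume i: "i \<in> {i. \<phi> x v i \<noteq> 0}"
      then obtain e where e: "e \<in> E" "i = \<iota> e" using \<phi>_out by blast
      then show "i \<in> \<iota> ` S x" using i \<phi>[OF e(1)] zero[OF v, of e] by auto
    qed
    then have "finite {i. \<phi> x v i \<noteq> 0}" using fin finite_subset by blast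
    moreover have "\<phi> x v (\<iota> e) \<in> interval_space (B (\<iota> e)) x" if e: "e \<in> E" for e
      using B[OF e] \<phi>[OF e, of x v] zero[OF v, of e] by (auto simp: interval_space_def S_def)
    ultimately show ?thesis using \<phi>_out by (auto simp: dsum_space_def)
  qed
  have add: "cf x (u + v) = (\<lambda>e. cf x u e + cf x v e)" if "u \<in> V x" "v \<in> V x" for x u v
    using cf[OF that(1)] cf[OF that(2)]
    by (intro cf_eq) (simp add: coords_def scale_left_distrib sum.distrib)
  have scale: "cf x (s k v) = (\<lambda>e. k * cf x v e)" if "v \<in> V x" for x k v
  proof (rule cf_eq)
    have v: "v = (\<Sum>e\<in>S x. s (cf x v e) (e x))" using cf[OF that] by (simp add: coords_def)
    have "s k v = (\<Sum>e\<in>S x. s (k * cf x v e) (e x))"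
      by (subst v) (simp add: scale_sum_right)
    then show "coords x (s k v) (\<lambda>e. k * cf x v e)" using zero[OF that] by (simp add: coords_def)
  qed
  have linear: "linear_between s (dsum_scale (*)) (V x) (dsum_space (\<iota> ` E) (\<lambda>i. interval_space (B i)) x) (\<phi> x)" for x
    unfolding linear_between_def
  proof (intro conjI ballI allI)
    show "\<phi> x ` V x \<subseteq> dsum_space (\<iota> ` E) (\<lambda>i. interval_space (B i)) x" using mem by blast
    show "\<phi> x (u + v) = \<phi> x u + \<phi> x v" if "u \<in> V x" "v \<in> V x" for u v
      by (rule family_ext) (simp_all add: \<phi> \<phi>_out add[OF that])
    show "\<phi> x (s c v) = dsum_scale (*) c (\<phi> x v)" if "v \<in> V x" for c v
      by (rule family_ext) (simp_all add: \<phi> \<phi>_out dsum_scale_def scale[OF that])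
  qed
  have bij: "bij_betw (\<phi> x) (V x) (dsum_space (\<iota> ` E) (\<lambda>i. interval_space (B i)) x)" for x
    unfolding bij_betw_def
  proof
    show "inj_on (\<phi> x) (V x)"
    proof (rule inj_onI)
      fix u v assume uv: "u \<in> V x" "v \<in> V x" "\<phi> x u = \<phi> x v"
      have "cf x u e = cf x v e" if "e \<in> S x" for e
        using \<phi>[of e x] uv(3) that by (simp add: S_def flip: \<phi>)
      then have "(\<Sum>e\<in>S x. s (cf x u e) (e x)) = (\<Sum>e\<in>S x. s (cf x v e) (e x))" by simp
      then show "u = v" using cf[OF uv(1)] cf[OF uv(2)] unfolding coords_def by metis
    qed
    show "\<phi> x ` V x = dsum_space (\<iota> ` E) (\<lambda>i. interval_space (B i)) x"
    proof (intro equalityI subsetI)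
      fix w :: "_ \<Rightarrow> 'k" assume w: "w \<in> dsum_space (\<iota> ` E) (\<lambda>i. interval_space (B i)) x"
      define c where "c e = (if e \<in> S x then w (\<iota> e) else 0)" for e
      define v where "v = (\<Sum>e\<in>S x. s (c e) (e x))"
      have "v \<in> V x"
        unfolding v_def using D(3) by (intro subspace_sum[OF subspace_V] subspace_scale[OF subspace_V]) (simp add: S_def)
      moreover have cv: "cf x v = c" by (rule cf_eq) (simp add: coords_def c_def v_def)
      have "\<phi> x v = w"
      proof (rule family_ext)
        show "\<phi> x v (\<iota> e) = w (\<iota> e)" if e: "e \<in> E" for e
        proof (cases "e x = 0")
          case True
          then have "w (\<iota> e) \<in> {0}"
            using w e B[OF e] unfolding dsum_space_def interval_space_def by fastforce
          then show ?thesis using \<phi>[OF e] cv True by (simp add: c_def S_def)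
        next
          case False
          then show ?thesis using \<phi>[OF e] cv e by (simp add: c_def S_def)
        qed
        show "\<phi> x v i = w i" if "i \<notin> \<iota> ` E" for i
          using w that \<phi>_out by (simp add: dsum_space_def)
      qed
      ultimately show "w \<in> \<phi> x ` V x" by blast
    qed (use mem in blast)
  qed
  have natural: "\<phi> y (f x y v) = dsum_map (\<iota> ` E) (\<lambda>i. interval_map (B i)) x y (\<phi> x v)"
    if xy: "x \<le> y" and v: "v \<in> V x" for x y v
  proof -
    define c where "c e = (if e \<in> S y then cf x v e else 0)" for e
    have sV: "s (cf x v e) (e x) \<in> V x" if "e \<in> S x" for e
      using that D(3) subspace_scale[OF subspace_V] by (simp add: S_def)
    have "f x y v = f x y (\<Sum>e\<in>S x. s (cf x v e) (e x))"
      using cf[OF v] unfolding coords_def by simp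
    also have "\<dots> = (\<Sum>e\<in>S x. f x y (s (cf x v e) (e x)))"
      using sV by (rule f_sum[OF xy])
    also have "\<dots> = (\<Sum>e\<in>S x. s (cf x v e) (e y))"
    proof (rule sum.cong)
      fix e assume "e \<in> S x"
      then show "f x y (s (cf x v e) (e x)) = s (cf x v e) (e y)"
        using f_scale[OF xy, of "e x"] D(3)[of e] D(4)[OF _ xy, of e] by (simp add: S_def)
    qed simp
    \<comment> \<open>Sections that are zero at \<open>y\<close> contribute nothing, and those that
      are zero at \<open>x\<close> have coefficient zero, so the sum can be moved from
      \<open>S x\<close> to \<open>S y\<close>.\<close>
    also have "\<dots> = (\<Sum>e\<in>S x \<union> S y. s (cf x v e) (e y))"
      using fin zero[OF v] by (intro sum.mono_neutral_left) auto
    also have "\<dots> = (\<Sum>e\<in>S y. s (c e) (e y))"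
      using fin by (intro sum.mono_neutral_cong_right) (auto simp: c_def S_def)
    finally have "coords y (f x y v) c" by (simp add: coords_def c_def)
    then have cf_f: "cf y (f x y v) = c" by (rule cf_eq)
    show ?thesis
    proof (rule family_ext)
      show "\<phi> y (f x y v) (\<iota> e) = dsum_map (\<iota> ` E) (\<lambda>i. interval_map (B i)) x y (\<phi> x v) (\<iota> e)"
        if e: "e \<in> E" for e
        using e zero[OF v, of e] by (auto simp: \<phi>[OF e] cf_f dsum_map_def interval_map_def B[OF e] c_def S_def)
      show "\<phi> y (f x y v) i = dsum_map (\<iota> ` E) (\<lambda>i. interval_map (B i)) x y (\<phi> x v) i"
        if "i \<notin> \<iota> ` E" for i
        using that by (simp add: \<phi>_out dsum_map_def)
    qed
  qed
  show ?thesis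
    unfolding vec_functor_iso_def using linear bij natural by blast
qed

end

theorem corollary6p10:
  fixes s :: "'k::field \<Rightarrow> 'v::ab_group_add \<Rightarrow> 'v"
    and V :: "ennreal \<times> ennreal \<Rightarrow> 'v set"
    and f :: "ennreal \<times> ennreal \<Rightarrow> ennreal \<times> ennreal \<Rightarrow> 'v \<Rightarrow> 'v"
  assumes "vec_functor s V f"
    and "pointwise_finite_dim s V"
    and "middle_exact V f"
  shows "\<exists>(A :: ((ennreal \<times> ennreal) set \<times> nat) set) B.
           (\<forall>i\<in>A. block (B i)) \<and>
           vec_functor_iso s V f
             (dsum_scale (*))
             (dsum_space A (\<lambda>i. interval_space (B i)))
             (dsum_map A (\<lambda>i. interval_map (B i)))"
proof -
  interpret vec_functor s V f by fact
  interpret rectangle_exact_functor s V f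
  proof
    show "pointwise_finite_dim s V" by fact
    fix a b c d :: ennreal and p q
    assume le: "a \<le> c" "b \<le> d" and pq: "p \<in> V (c, b)" "q \<in> V (a, d)" "f (c, b) (c, d) p = f (a, d) (c, d) q"
    have inf_sup: "inf (c, b) (a, d) = (a, b)" "sup (c, b) (a, d) = (c, d)"
      using le by (simp_all add: inf_prod_def sup_prod_def inf_absorb1 inf_absorb2 sup_absorb1 sup_absorb2)
    have "(p, q) \<in> (\<lambda>v. (f (a, b) (c, b) v, f (a, b) (a, d) v)) ` V (a, b)"
      using assms(3)[unfolded middle_exact_def, rule_format, of "(c, b)" "(a, d)"] pq
      unfolding inf_sup by simp
    then show "\<exists>v\<in>V (a, b). f (a, b) (c, b) v = p \<and> f (a, b) (a, d) v = q" by auto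
  qed
  obtain E where E: "partial_decomposition s V f E (\<lambda>_. {0})" using exists_decomposition .
  note D = partial_decompositionD[OF E]
  define supp where "supp e = {x. e x \<noteq> 0}" for e :: "ennreal \<times> ennreal \<Rightarrow> 'v"
  \<comment> \<open>An index is a block with a number telling apart the sections over it. These are
    all nonzero at a common point, hence finitely many, so \<open>to_nat_on\<close> is injective on
    them.\<close>
  define \<iota> where "\<iota> e = (supp e, to_nat_on {g \<in> E. supp g = supp e} e)" for e
  have "inj_on \<iota> E"
  proof (rule inj_onI)
    fix e g assume eg: "e \<in> E" "g \<in> E" "\<iota> e = \<iota> g"
    obtain x where "e x \<noteq> 0" using D(2)[OF eg(1)] by blast
    then have "{h \<in> E. supp h = supp e} \<subseteq> {h \<in> E. h x \<noteq> 0}" by (auto simp: supp_def)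
    then have "countable {h \<in> E. supp h = supp e}"
      using finite_nonvanishing_sections[OF E] by (meson countable_finite finite_subset)
    moreover have same: "supp g = supp e" using eg(3) by (simp add: \<iota>_def)
    moreover have "to_nat_on {h \<in> E. supp h = supp e} e = to_nat_on {h \<in> E. supp h = supp g} g"
      using eg(3) unfolding \<iota>_def prod.inject by (rule conjunct2)
    then have "to_nat_on {h \<in> E. supp h = supp e} e = to_nat_on {h \<in> E. supp h = supp e} g"
      by (simp only: same)
    ultimately show "e = g" using eg(1,2) same by (simp add: to_nat_on_inj)
  qed
  then have "vec_functor_iso s V f (dsum_scale (*))
      (dsum_space (\<iota> ` E) (\<lambda>i. interval_space (fst i))) (dsum_map (\<iota> ` E) (\<lambda>i. interval_map (fst i)))"
    by (rule iso_of_decomposition[OF E]) (simp add: \<iota>_def supp_def)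
  moreover have "\<forall>i\<in>\<iota> ` E. block (fst i)" using D(1) by (auto simp: \<iota>_def supp_def)
  ultimately show ?thesis by blast
qed

end
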